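(* Let $X$ and $E$ be real reflexive Banach spaces with $X$ compactly embedded in $E$, where $E$ is a Banach lattice with positive cone $P_1$, let $P=P_1\cap X$, and let $J:X\to\mathbb R$, $T:X\to X^*$, $\mathbf f:E\to E^*$ satisfy conditions (H$_1$), (H$_2$), (H$_3$), (H$_4$) listed in the context. Then the operator equation $$T(u)=\mathbf f(u)\quad\text{in }X^*$$ (i.e. $\langle T(u),w\rangle=(\mathbf f(u),w)$ for all $w\in X$) admits at least one positive solution, at least one negative solution and at least one sign-changing solution.
   Context: Setting. $X,E$ are real reflexive Banach spaces with norms $\|\cdot\|$, $\|\cdot\|_1$ and duals $X^*,E^*$; $\langle\cdot,\cdot\rangle$ is the pairing of $X^*$ and $X$, $(\cdot,\cdot)$ the pairing of $E^*$ and $E$. $X\subset E$ with compact embedding, so $\|x\|_1\le c_0\|x\|$ for all $x\in X$ and some $c_0>0$; elements of $E^*$ are regarded as elements of $X^*$ by restriction. $P_1\subset E$ is a (closed convex) cone inducing the order $x\le y\iff y-x\in P_1$; with this order $E$ is a Banach lattice, i.e. a Riesz space (vector lattice) such that $|x|\le|y|$ implies $\|x\|_1\le\|y\|_1$. Put $P=P_1\cap X$ and $P_1^*=\{h\in E^*:(h,u)\ge0\ \forall u\in P_1\}$. For $x\in E$: $x^+=x\vee0$, $x^-=(-x)\vee0$, $|x|=x^++x^-$, $x_+=x^+$, $x_-=-x^-$, so $x=x_++x_-$. For $u\in X$ the elements $u_\pm$ belong to $X$. Elements $x,y\in E$ are disjoint, $x\perp y$, if $|x|\wedge|y|=0$;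 a map $S$ from $E$ to a real vector space is orthogonally additive if $S(x+y)=S(x)+S(y)$ whenever $x\perp y$. Conditions. (H$_1$) $J:X\to\mathbb R$ is $C^1$ with $\langle J'(u),v\rangle=\langle T(u),v\rangle-(\mathbf f(u),v)$ for all $u,v\in X$, where $\mathbf f:E\to E^*$ and $T:X\to X^*$ are continuous, $\langle T(u),u_\pm\rangle=\langle T(u_\pm),u_\pm\rangle$ for all $u\in X$, and for some $c_1>0$ and $p\ge2$, $\langle T(u)-T(v),u-v\rangle\ge c_1\|u-v\|^p$ for all $u,v\in X$. (H$_2$) $\mathbf f:E\to E^*$ is orthogonally additive, $\mathbf f(P)\subset P_1^*$, $\mathbf f(-P)\subset -P_1^*$, and $(\mathbf f(u),w)\le g(\|u\|_1)\|w\|_1$ for all $u,w\in X$, where $g:\mathbb R^+\to\mathbb R^+$ is increasing and $\lim_{s\to0^+}g(s)/s^{p-1}=0$. (H$_3$) For each $u\in X\setminus\{0\}$, $\lim_{t\to+\infty}J(tu)=-\infty$. Under (H$_1$), $T:X\to X^*$ is a homeomorphism, and $A:X\to X$ denotes the continuous map defined by $\langle T(A(u)),w\rangle=(\mathbf f(u),w)$ for all $w\in X$. (H$_4$) If $\{u_n\}\subset X$ satisfies $\{u_n\}\subset J^{-1}([a,b])$ for some bounded interval $[a,b]\subset\mathbb R$ and $\|u_n-A(u_n)\|\to0$, then $\{u_n\}$ is bounded in $X$ and $J'(u_n)\to0$ in $X^*$. Solutions of $T(u)=\mathbf f(u)$ are exactly the elements of $K=\{u\in X:J'(u)=0\}$.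 A solution $u\in K\setminus\{0\}$ is called positive if $u\in P$, negative if $u\in-P$, and sign-changing if $u\notin P\cup(-P)$.
   Formalization: Two assumptions are added, without which the claim is false: X has dimension at least two (otherwise no element is sign-changing), and T(0)=0 (fails e.g. for X=E=R^2, T(u)=u+(10,10), f(u)=(u_1^3,u_2^3)). *)

theory Defs
  imports "HOL-Analysis.Analysis" "HOL-Library.Lattice_Algebras"
begin

text \<open>
  In the vector lattices below, \<open>pprt x = sup x 0\<close> is the positive part of \<open>x\<close> and
  \<open>pprt (- x)\<close> is the (nonnegative) element usually written \<open>x\<close> with superscript minus.
\<close>

definition modulus :: "'a::lattice_ab_group_add \<Rightarrow> 'a" where
  "modulus x = pprt x + pprt (- x)"

text \<open>The positive cone is \<open>{x. 0 \<le> x}\<close>, so that \<open>x \<le> y\<close> iff \<open>y - x\<close> lies in it; it is closed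
  because the lattice operations of a Banach lattice are norm continuous.\<close>

class banach_lattice = banach + ordered_real_vector + lattice_ab_group_add +
  assumes norm_le_if_modulus_le:
    "pprt x + pprt (- x) \<le> pprt y + pprt (- y) \<Longrightarrow> norm x \<le> norm y"

definition disjoint_elems :: "'a::lattice_ab_group_add \<Rightarrow> 'a \<Rightarrow> bool" where
  "disjoint_elems x y \<longleftrightarrow> inf (modulus x) (modulus y) = 0"

definition orthogonally_additive ::
    "('a::lattice_ab_group_add \<Rightarrow> 'b::real_vector) \<Rightarrow> bool" where
  "orthogonally_additive S \<longleftrightarrow> (\<forall>x y. disjoint_elems x y \<longrightarrow> S (x + y) = S x + S y)"

definition pos_cone :: "'e::banach_lattice set" where
  "pos_cone = {x. 0 \<le> x}"

definition dual_cone :: "('e::banach_lattice \<Rightarrow>\<^sub>L real) set" where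
  "dual_cone = {h. \<forall>u\<in>pos_cone. 0 \<le> blinfun_apply h u}"

text \<open>Surjectivity of the canonical embedding into the bidual.\<close>

definition reflexive_space :: "'a::real_normed_vector itself \<Rightarrow> bool" where
  "reflexive_space _ \<longleftrightarrow>
     (\<forall>\<phi> :: ('a \<Rightarrow>\<^sub>L real) \<Rightarrow>\<^sub>L real. \<exists>x. \<forall>h. blinfun_apply \<phi> h = blinfun_apply h x)"

text \<open>
  The inclusion of \<open>X\<close> (with its own norm) into \<open>E\<close> is represented by an injective bounded linear
  map \<open>\<iota>\<close>; \<open>u\<close> in \<open>X\<close> is identified with \<open>\<iota> u\<close>.
\<close>

definition compact_embedding ::
    "('x::real_normed_vector \<Rightarrow> 'e::real_normed_vector) \<Rightarrow> bool" where
  "compact_embedding \<iota> \<longleftrightarrow> bounded_linear \<iota> \<and> inj \<iota> \<and> (\<forall>B. bounded B \<longrightarrow> compact (closure (\<iota> ` B)))"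

definition cone_in :: "('x \<Rightarrow> 'e::banach_lattice) \<Rightarrow> 'x set" where
  "cone_in \<iota> = {u. \<iota> u \<in> pos_cone}"

text \<open>
  The elements \<open>u\<^sub>+\<close> and \<open>u\<^sub>-\<close> of \<open>X\<close>, where \<open>u = u\<^sub>+ + u\<^sub>-\<close> (so \<open>u\<^sub>-\<close> is nonpositive).
  They are meaningful when the two parts of \<open>\<iota> u\<close> lie in the range of \<open>\<iota>\<close>.
\<close>

definition plus_part :: "('x \<Rightarrow> 'e::banach_lattice) \<Rightarrow> 'x \<Rightarrow> 'x" where
  "plus_part \<iota> u = inv \<iota> (pprt (\<iota> u))"

definition minus_part :: "('x \<Rightarrow> 'e::banach_lattice) \<Rightarrow> 'x \<Rightarrow> 'x" where
  "minus_part \<iota> u = inv \<iota> (- pprt (- \<iota> u))"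

text \<open>The operator \<open>A\<close> with \<open>T (A u) = f u\<close> in the dual of \<open>X\<close>; the solution is unique when \<open>T\<close> is a
  bijection.\<close>

definition sol_op ::
    "('x::real_normed_vector \<Rightarrow> 'e::real_normed_vector) \<Rightarrow> ('x \<Rightarrow> 'x \<Rightarrow>\<^sub>L real) \<Rightarrow>
     ('e \<Rightarrow> 'e \<Rightarrow>\<^sub>L real) \<Rightarrow> 'x \<Rightarrow> 'x" where
  "sol_op \<iota> T f u =
     (THE v. \<forall>w. blinfun_apply (T v) w = blinfun_apply (f (\<iota> u)) (\<iota> w))"

definition is_solution ::
    "('x::real_normed_vector \<Rightarrow> 'e::real_normed_vector) \<Rightarrow> ('x \<Rightarrow> 'x \<Rightarrow>\<^sub>L real) \<Rightarrow>
     ('e \<Rightarrow> 'e \<Rightarrow>\<^sub>L real) \<Rightarrow> 'x \<Rightarrow> bool" where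
  "is_solution \<iota> T f u \<longleftrightarrow>
     (\<forall>w. blinfun_apply (T u) w = blinfun_apply (f (\<iota> u)) (\<iota> w))"

definition positive_solution ::
    "('x::real_normed_vector \<Rightarrow> 'e::banach_lattice) \<Rightarrow> ('x \<Rightarrow> 'x \<Rightarrow>\<^sub>L real) \<Rightarrow>
     ('e \<Rightarrow> 'e \<Rightarrow>\<^sub>L real) \<Rightarrow> 'x \<Rightarrow> bool" where
  "positive_solution \<iota> T f u \<longleftrightarrow> is_solution \<iota> T f u \<and> u \<noteq> 0 \<and> u \<in> cone_in \<iota>"

definition negative_solution ::
    "('x::real_normed_vector \<Rightarrow> 'e::banach_lattice) \<Rightarrow> ('x \<Rightarrow> 'x \<Rightarrow>\<^sub>L real) \<Rightarrow>
     ('e \<Rightarrow> 'e \<Rightarrow>\<^sub>L real) \<Rightarrow> 'x \<Rightarrow> bool" where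
  "negative_solution \<iota> T f u \<longleftrightarrow> is_solution \<iota> T f u \<and> u \<noteq> 0 \<and> - u \<in> cone_in \<iota>"

definition sign_changing_solution ::
    "('x::real_normed_vector \<Rightarrow> 'e::banach_lattice) \<Rightarrow> ('x \<Rightarrow> 'x \<Rightarrow>\<^sub>L real) \<Rightarrow>
     ('e \<Rightarrow> 'e \<Rightarrow>\<^sub>L real) \<Rightarrow> 'x \<Rightarrow> bool" where
  "sign_changing_solution \<iota> T f u \<longleftrightarrow>
     is_solution \<iota> T f u \<and> u \<noteq> 0 \<and> u \<notin> cone_in \<iota> \<and> - u \<notin> cone_in \<iota>"

end

theory Submission
  imports Defs
begin

text \<open>
  The map \<open>A\<close> with \<open>T (A u) = f u\<close> exists by the Browder--Minty theorem, and \<open>A u - u\<close> is a descent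
  direction: \<open>J' u (A u - u) \<le> - c1 \<parallel>u - A u\<parallel>\<^sup>p\<close>. Because \<open>f\<close> is small near \<open>0\<close>, \<open>A\<close> maps the two cones
  and their small neighbourhoods (measured by \<open>\<parallel>u\<^sup>-\<parallel>\<close> and \<open>\<parallel>u\<^sup>+\<parallel>\<close> in \<open>E\<close>) into themselves, and these
  sets are convex, so they are preserved by \<open>u \<mapsto> u + \<tau> (A u - u)\<close> with \<open>0 \<le> \<tau> \<le> 1\<close>. No descending flow
  is needed: Ekeland's principle is applied to the functional \<open>\<phi> \<mapsto> sup J\<close> on a complete space of
  continuous maps, and an almost minimal \<open>\<phi>\<close> is perturbed once by such a step, for which continuity
  of \<open>A\<close> suffices.

  The signed solutions come from paths from \<open>0\<close> to a far point inside a cone. For the sign-changing one,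
  take maps of a square with two opposite sides in the two cones, one side collapsed to \<open>0\<close>
  and the fourth on a fixed path where \<open>J < J 0\<close>; the supremum is taken only over points outside both
  neighbourhoods. By Poincare--Miranda the image meets \<open>\<parallel>u\<^sup>+\<parallel> = \<parallel>u\<^sup>-\<parallel> = 2\<epsilon>\<close>, where \<open>J\<close> is bounded below by
  a number larger than \<open>J 0\<close>.
\<close>

section \<open>The Browder--Minty theorem\<close>

text \<open>The derivative \<open>2 * max 0 x\<close> of \<open>(max 0 x)\<^sup>2\<close> is
  Lipschitz with constant 2, which gives this quadratic majorant. It stands in for a derivative of
  \<Phi> in the minimisation below.\<close>

lemma pos_part_square_add_le:
  fixes x y :: real
  shows "(max 0 (x + y))\<^sup>2 \<le> (max 0 x)\<^sup>2 + 2 * y * max 0 x + y\<^sup>2"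
proof -
  have "\<bar>max 0 (x + y)\<bar> \<le> \<bar>max 0 x + y\<bar> \<or> (x < 0 \<and> max 0 (x + y) \<le> \<bar>y\<bar>)"
    by (auto simp: max_def)
  then show ?thesis
  proof
    assume "\<bar>max 0 (x + y)\<bar> \<le> \<bar>max 0 x + y\<bar>"
    then have "(max 0 (x + y))\<^sup>2 \<le> (max 0 x + y)\<^sup>2"
      by (simp only: abs_le_square_iff)
    then show ?thesis by (simp add: power2_eq_square algebra_simps)
  next
    assume *: "x < 0 \<and> max 0 (x + y) \<le> \<bar>y\<bar>"
    then have "(max 0 (x + y))\<^sup>2 \<le> \<bar>y\<bar>\<^sup>2"
      by (intro power_mono) auto
    then show ?thesis using * by simp
  qed
qed

text \<open>First-order condition at a minimum: divide by \<open>t\<close> and let \<open>t\<close>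
  tend to 0 from the right.\<close>

lemma nonneg_linear_of_quadratic:
  fixes a b :: real
  assumes "\<And>t. 0 < t \<Longrightarrow> t \<le> 1 \<Longrightarrow> 0 \<le> t * a + t\<^sup>2 * b"
  shows "0 \<le> a"
proof (rule tendsto_lowerbound)
  show "((\<lambda>t. a + t * b) \<longlongrightarrow> a) (at_right 0)"
    by (auto intro!: tendsto_eq_intros)
  have "0 \<le> a + t * b" if "0 < t" "t < 1" for t
    using assms[of t] that by (simp add: power2_eq_square mult.assoc flip: distrib_left) (simp add: zero_le_mult_iff)
  then show "\<forall>\<^sub>F t in at_right 0. 0 \<le> a + t * b"
    by (auto simp: eventually_at_right[of 0 1] intro!: exI[of _ 1])
qed simp

text \<open>Finite form of Minty's inequality. Minimising the sum of squared violations over the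
  compact hull takes the place of a fixed-point argument.\<close>

lemma monotone_finite_VI:
  fixes a :: "'a::real_normed_vector \<Rightarrow> 'a \<Rightarrow>\<^sub>L real"
  assumes fin: "finite F" and ne: "F \<noteq> {}"
    and mono: "\<And>u w. u \<in> F \<Longrightarrow> w \<in> F \<Longrightarrow> 0 \<le> blinfun_apply (a u - a w) (u - w)"
  shows "\<exists>v\<in>convex hull F. \<forall>u\<in>F. blinfun_apply (a u) (v - u) \<le> 0"
proof -
  \<comment> \<open>At a minimiser \<open>v\<close> of \<open>\<Phi>\<close> with weights \<open>y\<close> not all zero, the derivative towards the weighted mean
    \<open>\<nu>\<close> of the points is negative by monotonicity.\<close>
  define \<Phi> where "\<Phi> v = (\<Sum>u\<in>F. (max 0 (blinfun_apply (a u) (v - u)))\<^sup>2)" for v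
  have "continuous_on (convex hull F) \<Phi>"
    unfolding \<Phi>_def by (intro continuous_intros)
  then obtain v where v: "v \<in> convex hull F" and v_min: "\<And>w. w \<in> convex hull F \<Longrightarrow> \<Phi> v \<le> \<Phi> w"
    using continuous_attains_inf[OF finite_imp_compact_convex_hull[OF fin], of \<Phi>] ne
    by (auto simp: convex_hull_eq_empty)
  define y where "y u = max 0 (blinfun_apply (a u) (v - u))" for u
  define Y where "Y = sum y F"
  have y_nonneg: "0 \<le> y u" for u by (simp add: y_def)
  have "Y = 0"
  proof (rule ccontr)
    assume "Y \<noteq> 0"
    then have Y: "0 < Y" unfolding Y_def using sum_nonneg[of F y] y_nonneg by force
    define \<nu> where "\<nu> = (\<Sum>u\<in>F. (y u / Y) *\<^sub>R u)"
    have \<nu>: "\<nu> \<in> convex hull F"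
      unfolding \<nu>_def using Y y_nonneg fin
      by (intro convex_sum) (auto simp: hull_inc Y_def sum_divide_distrib[symmetric])
    have "0 \<le> t * (2 * (\<Sum>u\<in>F. blinfun_apply (a u) (\<nu> - v) * y u))
              + t\<^sup>2 * (\<Sum>u\<in>F. (blinfun_apply (a u) (\<nu> - v))\<^sup>2)" if t: "0 < t" "t \<le> 1" for t
    proof -
      have "(1 - t) *\<^sub>R v + t *\<^sub>R \<nu> \<in> convex hull F"
        using convexD[OF convex_convex_hull v \<nu>, of "1 - t" t] t by simp
      then have "\<Phi> v \<le> \<Phi> ((1 - t) *\<^sub>R v + t *\<^sub>R \<nu>)" by (rule v_min)
      also have "\<dots> = (\<Sum>u\<in>F. (max 0 (blinfun_apply (a u) (v - u) + t * blinfun_apply (a u) (\<nu> - v)))\<^sup>2)"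
        unfolding \<Phi>_def by (intro sum.cong refl) (simp add: blinfun.bilinear_simps algebra_simps)
      also have "\<dots> \<le> (\<Sum>u\<in>F. (y u)\<^sup>2 + 2 * (t * blinfun_apply (a u) (\<nu> - v)) * y u
                         + (t * blinfun_apply (a u) (\<nu> - v))\<^sup>2)"
        unfolding y_def by (intro sum_mono pos_part_square_add_le)
      also have "\<dots> = \<Phi> v + (t * (2 * (\<Sum>u\<in>F. blinfun_apply (a u) (\<nu> - v) * y u))
              + t\<^sup>2 * (\<Sum>u\<in>F. (blinfun_apply (a u) (\<nu> - v))\<^sup>2))"
        by (simp add: sum.distrib \<Phi>_def y_def sum_distrib_left power_mult_distrib algebra_simps)
      finally show ?thesis by simp
    qed
    then have "0 \<le> 2 * (\<Sum>u\<in>F. blinfun_apply (a u) (\<nu> - v) * y u)"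
      by (rule nonneg_linear_of_quadratic)
    moreover have "(\<Sum>u\<in>F. blinfun_apply (a u) (\<nu> - v) * y u)
        = (\<Sum>u\<in>F. blinfun_apply (a u) (\<nu> - u) * y u) - (\<Sum>u\<in>F. (y u)\<^sup>2)"
      unfolding sum_subtractf[symmetric]
    proof (intro sum.cong refl)
      fix u
      have "blinfun_apply (a u) (v - u) * y u = (y u)\<^sup>2"
        by (auto simp: y_def max_def power2_eq_square)
      then show "blinfun_apply (a u) (\<nu> - v) * y u = blinfun_apply (a u) (\<nu> - u) * y u - (y u)\<^sup>2"
        by (simp add: blinfun.bilinear_simps algebra_simps)
    qed
    moreover have "(\<Sum>u\<in>F. blinfun_apply (a u) (\<nu> - u) * y u) \<le> 0"
    proof -
      define S where "S = (\<Sum>u\<in>F. \<Sum>w\<in>F. y u * y w * blinfun_apply (a u) (w - u))"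
      have "blinfun_apply (a u) (\<nu> - u) = (\<Sum>w\<in>F. y w / Y * blinfun_apply (a u) (w - u))" for u
      proof -
        have "(\<Sum>w\<in>F. y w / Y) = 1" using Y by (simp add: Y_def sum_divide_distrib[symmetric])
        then have "blinfun_apply (a u) u = (\<Sum>w\<in>F. y w / Y * blinfun_apply (a u) u)"
          by (metis mult_1 sum_distrib_right)
        then show ?thesis
          unfolding \<nu>_def by (simp add: blinfun.bilinear_simps blinfun.sum_right right_diff_distrib sum_subtractf)
      qed
      then have "(\<Sum>u\<in>F. blinfun_apply (a u) (\<nu> - u) * y u) = S / Y"
        unfolding S_def by (simp add: sum_divide_distrib sum_distrib_left sum_distrib_right algebra_simps)
      \<comment> \<open>Adding to \<open>S\<close> its copy with the indices exchanged pairs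
        \<open>a u\<close> with \<open>a w\<close>; monotonicity then fixes the sign of each
        term.\<close>
      moreover have "2 * S = (\<Sum>u\<in>F. \<Sum>w\<in>F. y u * y w * - blinfun_apply (a u - a w) (u - w))"
      proof -
        have "S = (\<Sum>u\<in>F. \<Sum>w\<in>F. y w * y u * blinfun_apply (a w) (u - w))"
          unfolding S_def by (rule sum.swap)
        then have "2 * S = (\<Sum>u\<in>F. \<Sum>w\<in>F. y u * y w * blinfun_apply (a u) (w - u)
                        + y w * y u * blinfun_apply (a w) (u - w))"
          by (simp add: sum.distrib S_def[symmetric])
        also have "\<dots> = (\<Sum>u\<in>F. \<Sum>w\<in>F. y u * y w * - blinfun_apply (a u - a w) (u - w))"
          by (intro sum.cong refl) (simp add: blinfun.bilinear_simps algebra_simps)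
        finally show ?thesis .
      qed
      moreover have "\<dots> \<le> 0"
        using mono y_nonneg by (intro sum_nonpos) (simp add: mult_nonneg_nonneg)
      ultimately show ?thesis using Y by (simp add: divide_le_0_iff)
    qed
    ultimately have "(\<Sum>u\<in>F. (y u)\<^sup>2) \<le> 0" by linarith
    then have "(\<Sum>u\<in>F. (y u)\<^sup>2) = 0" by (intro antisym sum_nonneg) auto
    then have "y u = 0" if "u \<in> F" for u using that fin by (simp add: sum_nonneg_eq_0_iff)
    then have "Y = 0" by (simp add: Y_def)
    with Y show False by simp
  qed
  then have "y u = 0" if "u \<in> F" for u
    using that fin y_nonneg by (simp add: Y_def sum_nonneg_eq_0_iff)
  then have "blinfun_apply (a u) (v - u) \<le> 0" if "u \<in> F" for u
    using that unfolding y_def by (metis max.cobounded2)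
  then show ?thesis using v by blast
qed

section \<open>Weak compactness in reflexive spaces and Minty's method\<close>

text \<open>Weak compactness of balls, as a finite intersection property for half-spaces. As in
  Banach--Alaoglu, evaluations at points of the ball lie in a compact product of intervals; a common
  point of all the closed conditions is a bounded functional on the dual, hence evaluation at some
  \<open>v\<close> by reflexivity.\<close>

lemma reflexive_fip:
  fixes H :: "'i set" and a :: "'i \<Rightarrow> 'a::real_normed_vector \<Rightarrow>\<^sub>L real" and b :: "'i \<Rightarrow> real"
  assumes refl: "reflexive_space TYPE('a)"
    and fip: "\<And>F. finite F \<Longrightarrow> F \<subseteq> H \<Longrightarrow>
                \<exists>v. norm v \<le> R \<and> (\<forall>i\<in>F. blinfun_apply (a i) v \<le> b i)"
  shows "\<exists>v. \<forall>i\<in>H. blinfun_apply (a i) v \<le> b i"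
proof -
  define K :: "(('a \<Rightarrow>\<^sub>L real) \<Rightarrow> real) set" where "K = (\<Pi>\<^sub>E h\<in>UNIV. {- (R * norm h)..R * norm h})"
  have "compactin (product_topology (\<lambda>_. euclidean) UNIV) K"
    unfolding K_def by (subst compactin_PiE) auto
  then have K: "compact K"
    by (simp add: euclidean_product_topology)
  note [continuous_intros] = continuous_on_product_coordinates
  \<comment> \<open>Linearity is cut out by the closed sets \<open>L\<close>, one for each pair of
    functionals and scalars; \<open>D i\<close> is the \<open>i\<close>-th half-space. Both
    constrain only finitely many coordinates.\<close>
  define L where "L = (\<lambda>(h, k, r, s). {\<psi> :: ('a \<Rightarrow>\<^sub>L real) \<Rightarrow> real. \<psi> (r *\<^sub>R h + s *\<^sub>R k) = r * \<psi> h + s * \<psi> k})"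
  define D where "D i = {\<psi> :: ('a \<Rightarrow>\<^sub>L real) \<Rightarrow> real. \<psi> (a i) \<le> b i}" for i
  have ev_K: "(\<lambda>h. blinfun_apply h v) \<in> K" if "norm v \<le> R" for v
  proof -
    have "\<bar>blinfun_apply h v\<bar> \<le> R * norm h" for h :: "'a \<Rightarrow>\<^sub>L real"
      using norm_blinfun[of h v] mult_left_mono[OF that, of "norm h"] by (simp add: mult.commute)
    then have "- (R * norm h) \<le> blinfun_apply h v \<and> blinfun_apply h v \<le> R * norm h" for h :: "'a \<Rightarrow>\<^sub>L real"
      by (metis abs_le_iff minus_le_iff)
    then show ?thesis by (auto simp: K_def)
  qed
  have "K \<inter> \<Inter>(range L \<union> D ` H) \<noteq> {}"
  proof (rule compact_imp_fip[OF K])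
    fix S assume "S \<in> range L \<union> D ` H"
    then show "closed S"
      by (auto simp: L_def D_def intro!: closed_Collect_eq closed_Collect_le continuous_intros)
  next
    fix F' assume "finite F'" "F' \<subseteq> range L \<union> D ` H"
    then have "finite (F' \<inter> D ` H)" "F' \<inter> D ` H \<subseteq> D ` H" by auto
    then obtain F where F: "finite F" "F \<subseteq> H" "F' \<inter> D ` H = D ` F"
      by (meson finite_subset_image)
    obtain v where v: "norm v \<le> R" "\<And>i. i \<in> F \<Longrightarrow> blinfun_apply (a i) v \<le> b i"
      using fip[OF F(1,2)] by blast
    have "(\<lambda>h. blinfun_apply h v) \<in> S" if "S \<in> F'" for S
    proof (cases "S \<in> D ` H")
      case True
      then have "S \<in> D ` F" using F that by blast
      then show ?thesis using v by (auto simp: D_def)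
    next
      case False
      then have "S \<in> range L" using that \<open>F' \<subseteq> _\<close> by blast
      then show ?thesis by (auto simp: L_def blinfun.bilinear_simps)
    qed
    then show "K \<inter> \<Inter>F' \<noteq> {}" using ev_K[OF v(1)] by blast
  qed
  then obtain \<psi> where \<psi>: "\<psi> \<in> K" "\<And>h k r s. \<psi> \<in> L (h, k, r, s)" "\<And>i. i \<in> H \<Longrightarrow> \<psi> \<in> D i"
    by blast
  have lin: "\<psi> (r *\<^sub>R h + s *\<^sub>R k) = r * \<psi> h + s * \<psi> k" for r s h k
    using \<psi>(2)[of h k r s] by (simp add: L_def)
  have "bounded_linear \<psi>"
  proof (rule bounded_linear_intro)
    show "\<psi> (x + y) = \<psi> x + \<psi> y" for x y using lin[of 1 x 1 y] by simp
    show "\<psi> (r *\<^sub>R x) = r *\<^sub>R \<psi> x" for r x using lin[of r x 0 0] by simp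
    show "norm (\<psi> x) \<le> norm x * R" for x
      using \<psi>(1) by (auto simp: K_def abs_le_iff mult.commute dest!: PiE_mem[of _ _ _ x])
  qed
  then obtain v where "\<And>h. \<psi> h = blinfun_apply h v"
    using refl unfolding reflexive_space_def by (metis bounded_linear_Blinfun_apply)
  then show ?thesis using \<psi>(3) by (auto simp: D_def)
qed

text \<open>Minty's method: the inequality with \<open>T u\<close> instead of \<open>T v\<close> is
  affine in \<open>v\<close>, so finite families of test points suffice by weak compactness.
  Continuity of \<open>T\<close> along segments from \<open>v\<close> then brings back
  \<open>T v\<close>.\<close>

theorem Browder_Minty:
  fixes T :: "'a::real_normed_vector \<Rightarrow> 'a \<Rightarrow>\<^sub>L real"
  assumes refl: "reflexive_space TYPE('a)"
    and cont: "continuous_on UNIV T"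
    and mono: "\<And>u v. 0 \<le> blinfun_apply (T u - T v) (u - v)"
    and r: "r > 0"
    and coercive: "\<And>u. norm u = r \<Longrightarrow> blinfun_apply h u < blinfun_apply (T u) u"
  shows "\<exists>v. T v = h"
proof -
  \<comment> \<open>The radius \<open>r + 1\<close> leaves room around the ball of radius
    \<open>r\<close>, so that \<open>v + t *\<^sub>R w\<close> is an admissible test point for small
    \<open>t\<close>.\<close>
  have "\<exists>v. \<forall>u\<in>cball 0 (r + 1). blinfun_apply (T u - h) v \<le> blinfun_apply (T u - h) u"
  proof (rule reflexive_fip[OF refl])
    fix F :: "'a set" assume F: "finite F" "F \<subseteq> cball 0 (r + 1)"
    show "\<exists>v. norm v \<le> r + 1 \<and> (\<forall>u\<in>F. blinfun_apply (T u - h) v \<le> blinfun_apply (T u - h) u)"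
    proof (cases "F = {}")
      case True
      then show ?thesis using r by (intro exI[of _ 0]) auto
    next
      case False
      obtain v where v: "v \<in> convex hull F" "\<forall>u\<in>F. blinfun_apply (T u - h) (v - u) \<le> 0"
        using monotone_finite_VI[OF F(1) False, of "\<lambda>u. T u - h"] mono by (auto simp: blinfun.diff_left)
      moreover have "convex hull F \<subseteq> cball 0 (r + 1)"
        using F(2) by (intro hull_minimal convex_cball)
      ultimately show ?thesis by (intro exI[of _ v]) (auto simp: blinfun.diff_right)
    qed
  qed
  then obtain v where "\<forall>u\<in>cball 0 (r + 1). blinfun_apply (T u - h) v \<le> blinfun_apply (T u - h) u"
    by blast
  then have v: "0 \<le> blinfun_apply (T u - h) (u - v)" if "norm u \<le> r + 1" for u
    using that by (simp add: blinfun.diff_right)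
  \<comment> \<open>Compactness supplies no norm bound, so coercivity does: if \<open>v\<close> were
    farther out, its radial projection to the sphere of radius \<open>r\<close> would be a test
    point violating the inequality.\<close>
  have "norm v \<le> r"
  proof (rule ccontr)
    assume "\<not> norm v \<le> r"
    define s where "s = r / norm v"
    have "0 < norm v" using r \<open>\<not> norm v \<le> r\<close> by linarith
    then have s: "0 < s" "s < 1" "norm (s *\<^sub>R v) = r"
      using r \<open>\<not> norm v \<le> r\<close> by (auto simp: s_def)
    have "0 < s * blinfun_apply (T (s *\<^sub>R v) - h) v"
      using coercive[OF s(3)] by (simp add: blinfun.bilinear_simps algebra_simps)
    moreover have "0 \<le> (s - 1) * blinfun_apply (T (s *\<^sub>R v) - h) v"
      using v[of "s *\<^sub>R v"] s by (simp add: blinfun.bilinear_simps algebra_simps)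
    ultimately show False using s by (simp add: zero_less_mult_iff zero_le_mult_iff)
  qed
  have ge: "0 \<le> blinfun_apply (T v - h) w" for w
  proof (rule tendsto_lowerbound)
    have "isCont T v" using cont by (simp add: continuous_on_eq_continuous_at)
    moreover have "((\<lambda>t. v + t *\<^sub>R w) \<longlongrightarrow> v) (at_right 0)"
      by (auto intro!: tendsto_eq_intros)
    ultimately have "((\<lambda>t. T (v + t *\<^sub>R w)) \<longlongrightarrow> T v) (at_right 0)"
      by (rule isCont_tendsto_compose)
    then show "((\<lambda>t. blinfun_apply (T (v + t *\<^sub>R w) - h) w) \<longlongrightarrow> blinfun_apply (T v - h) w) (at_right 0)"
      by (intro tendsto_intros)
    have "((\<lambda>t. norm (v + t *\<^sub>R w)) \<longlongrightarrow> norm v) (at_right 0)"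
      by (auto intro!: tendsto_eq_intros)
    then have "\<forall>\<^sub>F t in at_right 0. norm (v + t *\<^sub>R w) < r + 1"
      using \<open>norm v \<le> r\<close> by (intro order_tendstoD) auto
    moreover have "\<forall>\<^sub>F t::real in at_right 0. 0 < t" by (simp add: eventually_at_right_less)
    ultimately show "\<forall>\<^sub>F t in at_right 0. 0 \<le> blinfun_apply (T (v + t *\<^sub>R w) - h) w"
    proof eventually_elim
      case (elim t)
      then have "0 \<le> t * blinfun_apply (T (v + t *\<^sub>R w) - h) w"
        using v[of "v + t *\<^sub>R w"] by (simp add: blinfun.bilinear_simps)
      then show ?case using elim by (simp add: zero_le_mult_iff)
    qed
  qed simp
  have "blinfun_apply (T v - h) w = 0" for w
    using ge[of w] ge[of "- w"] by (simp add: blinfun.minus_right)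
  then have "T v - h = 0" by (intro blinfun_eqI) simp
  then show ?thesis by (intro exI[of _ v]) simp
qed

section \<open>Ekeland's principle and a minimax lemma\<close>

text \<open>Each step moves within the set \<open>S\<close> of points that pay for their distance by
  a decrease of \<open>I\<close>, and almost minimises \<open>I\<close> there. Distances are bounded
  by decreases of \<open>I\<close>, so the sequence is Cauchy; its limit lies in every
  \<open>S (x n)\<close> and cannot be improved. Lower semicontinuity is stated through closed
  sublevel sets.\<close>

lemma Ekeland_principle:
  fixes I :: "'a::complete_space \<Rightarrow> real"
  assumes lsc: "\<And>a. closed {\<phi>\<in>\<Gamma>. I \<phi> \<le> a}"
    and bdd: "\<And>\<phi>. \<phi> \<in> \<Gamma> \<Longrightarrow> m \<le> I \<phi>"
    and \<phi>0: "\<phi>0 \<in> \<Gamma>" and \<epsilon>: "\<epsilon> > 0"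
  obtains \<phi> where "\<phi> \<in> \<Gamma>" "I \<phi> \<le> I \<phi>0"
    "\<And>\<psi>. \<psi> \<in> \<Gamma> \<Longrightarrow> I \<psi> + \<epsilon> * dist \<phi> \<psi> \<le> I \<phi> \<Longrightarrow> \<psi> = \<phi>"
proof -
  define S where "S \<phi> = {\<psi>\<in>\<Gamma>. I \<psi> + \<epsilon> * dist \<phi> \<psi> \<le> I \<phi>}" for \<phi>
  have S_trans: "\<xi> \<in> S \<phi>" if "\<psi> \<in> S \<phi>" "\<xi> \<in> S \<psi>" for \<phi> \<psi> \<xi>
  proof -
    have "\<epsilon> * dist \<phi> \<xi> \<le> \<epsilon> * dist \<phi> \<psi> + \<epsilon> * dist \<psi> \<xi>"
      using \<epsilon> by (simp add: dist_triangle flip: distrib_left)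
    then show ?thesis using that by (auto simp: S_def)
  qed
  have bddS: "bdd_below (I ` S \<phi>)" for \<phi>
    using bdd by (auto simp: S_def bdd_below_def)
  have "\<exists>\<psi>\<in>S \<phi>. I \<psi> \<le> Inf (I ` S \<phi>) + (1/2) ^ n" if "\<phi> \<in> \<Gamma>" for \<phi> and n :: nat
  proof -
    have ne: "I ` S \<phi> \<noteq> {}" using that by (force simp: S_def)
    obtain y where "y \<in> I ` S \<phi>" "y < Inf (I ` S \<phi>) + (1/2) ^ n"
      using cInf_lessD[OF ne, of "Inf (I ` S \<phi>) + (1/2) ^ n"] by auto
    then show ?thesis by (auto intro: less_imp_le)
  qed
  then have "\<exists>x. \<forall>n. (x n \<in> \<Gamma> \<and> (n = 0 \<longrightarrow> x n = \<phi>0)) \<and>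
      (x (Suc n) \<in> S (x n) \<and> I (x (Suc n)) \<le> Inf (I ` S (x n)) + (1/2) ^ n)"
    by (intro dependent_nat_choice) (use \<phi>0 in \<open>auto simp: S_def\<close>)
  then obtain x where x_in: "\<And>n. x n \<in> \<Gamma>" and x_0: "x 0 = \<phi>0"
    and x_Suc: "\<And>n. x (Suc n) \<in> S (x n)" and x_Inf: "\<And>n. I (x (Suc n)) \<le> Inf (I ` S (x n)) + (1/2) ^ n"
    by metis
  have S_le: "x m \<in> S (x n)" if "n \<le> m" for m n
    using that
  proof (induction rule: dec_induct)
    case base
    then show ?case using x_in by (simp add: S_def)
  qed (use S_trans x_Suc in blast)
  have I_le: "I (x m) + \<epsilon> * dist (x n) (x m) \<le> I (x n)" if "n \<le> m" for m n
    using S_le[OF that] by (simp add: S_def)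
  have "decseq (\<lambda>n. I (x n))"
    using I_le \<epsilon> by (auto simp: decseq_def) (smt (verit) mult_nonneg_nonneg zero_le_dist)
  then have "Cauchy (\<lambda>n. I (x n))"
    using decseq_convergent[of "\<lambda>n. I (x n)" m] bdd[OF x_in] by (metis convergent_Cauchy convergent_def)
  have "Cauchy x"
  proof (rule metric_CauchyI)
    fix e :: real assume "e > 0"
    then obtain N where N: "\<And>k n. k \<ge> N \<Longrightarrow> n \<ge> N \<Longrightarrow> dist (I (x k)) (I (x n)) < \<epsilon> * e"
      using \<open>Cauchy (\<lambda>n. I (x n))\<close> \<epsilon> unfolding Cauchy_def by (metis mult_pos_pos)
    have *: "dist (x n) (x k) < e" if "N \<le> n" "n \<le> k" for n k
    proof -
      have "\<epsilon> * dist (x n) (x k) \<le> dist (I (x n)) (I (x k))"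
        using I_le[OF that(2)] by (simp add: dist_real_def)
      also have "\<dots> < \<epsilon> * e" using N that by simp
      finally show ?thesis using \<epsilon> by simp
    qed
    show "\<exists>M. \<forall>k\<ge>M. \<forall>n\<ge>M. dist (x k) (x n) < e"
      by (rule exI[of _ N]) (metis * dist_commute linear)
  qed
  then obtain \<phi> where lim: "x \<longlonglongrightarrow> \<phi>"
    using Cauchy_convergent convergent_def by blast
  have \<phi>S: "\<phi> \<in> S (x n)" for n
  proof -
    \<comment> \<open>A sublevel set with a level independent of \<open>k\<close> is required, so
      the distance to \<open>x k\<close> is replaced by that to the limit at the price of a slack
      \<eta>.\<close>
    have *: "\<phi> \<in> \<Gamma> \<and> I \<phi> \<le> I (x n) - \<epsilon> * dist (x n) \<phi> + \<eta>" if "\<eta> > 0" for \<eta>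
    proof -
      have "(\<lambda>k. \<epsilon> * dist (x n) (x k)) \<longlonglongrightarrow> \<epsilon> * dist (x n) \<phi>"
        using lim by (intro tendsto_intros)
      then have "\<forall>\<^sub>F k in sequentially. \<epsilon> * dist (x n) \<phi> - \<eta> < \<epsilon> * dist (x n) (x k)"
        by (rule order_tendstoD) (use that in simp)
      then have "\<forall>\<^sub>F k in sequentially. x k \<in> {\<psi>\<in>\<Gamma>. I \<psi> \<le> I (x n) - \<epsilon> * dist (x n) \<phi> + \<eta>}"
        using eventually_ge_at_top[of n]
      proof eventually_elim
        case (elim k)
        then show ?case using I_le[of n k] x_in by simp
      qed
      then show ?thesis using Lim_in_closed_set[OF lsc _ sequentially_bot lim] by blast
    qed
    then have "I \<phi> \<le> I (x n) - \<epsilon> * dist (x n) \<phi>"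
      by (metis field_le_epsilon)
    then show ?thesis using * [of 1] by (simp add: S_def)
  qed
  show ?thesis
  proof
    show "\<phi> \<in> \<Gamma>" using \<phi>S by (simp add: S_def)
    show "I \<phi> \<le> I \<phi>0"
      using \<phi>S[of 0] x_0 \<epsilon> by (simp add: S_def) (smt (verit) mult_nonneg_nonneg zero_le_dist)
    fix \<psi> assume "\<psi> \<in> \<Gamma>" and le: "I \<psi> + \<epsilon> * dist \<phi> \<psi> \<le> I \<phi>"
    then have "\<psi> \<in> S (x n)" for n
      using S_trans[OF \<phi>S] by (simp add: S_def)
    then have "Inf (I ` S (x n)) \<le> I \<psi>" for n
      by (intro cInf_lower bddS imageI)
    moreover have "I \<phi> \<le> I (x (Suc n))" for n
      using \<phi>S[of "Suc n"] \<epsilon> by (simp add: S_def) (smt (verit) mult_nonneg_nonneg zero_le_dist)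
    ultimately have *: "I \<phi> \<le> I \<psi> + (1/2) ^ n" for n
      using x_Inf by (smt (verit))
    have "(\<lambda>n. I \<psi> + (1/2) ^ n) \<longlonglongrightarrow> I \<psi> + 0"
      by (intro tendsto_intros LIMSEQ_power_zero) auto
    then have "I \<phi> \<le> I \<psi>"
      using * by (intro LIMSEQ_le_const[of "\<lambda>n. I \<psi> + (1/2) ^ n"]) auto
    then have "\<epsilon> * dist \<phi> \<psi> \<le> 0" using le by simp
    then show "\<psi> = \<phi>" using \<epsilon> by (simp add: mult_le_0_iff)
  qed
qed

text \<open>A Lebesgue number makes the radius uniform over base points in \<open>K\<close>,
  although \<open>u + v\<close> may leave \<open>K\<close>; the mean value theorem does the
  rest.\<close>

lemma C1_expansion_uniform_on_compact:
  fixes J :: "'a::real_normed_vector \<Rightarrow> real" and J' :: "'a \<Rightarrow> 'a \<Rightarrow>\<^sub>L real"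
  assumes deriv: "\<And>u. (J has_derivative blinfun_apply (J' u)) (at u)"
    and cont: "continuous_on UNIV J'" and K: "compact K" and \<rho>: "\<rho> > 0"
  obtains r where "r > 0"
    "\<And>u v. u \<in> K \<Longrightarrow> norm v < r \<Longrightarrow> J (u + v) \<le> J u + blinfun_apply (J' u) v + \<rho> * norm v"
proof -
  \<comment> \<open>Radius \<open>\<rho>/2\<close> ensures that derivatives at two points of one
    member of the cover differ by at most \<rho>.\<close>
  let ?G = "(\<lambda>h. J' -` ball h (\<rho>/2)) ` UNIV"
  have "open G" if "G \<in> ?G" for G
    using that cont by (auto intro!: open_vimage)
  moreover have "K \<subseteq> \<Union>?G" using \<rho> by auto (metis dist_self mult_zero_left)
  ultimately obtain r where r: "0 < r" "\<forall>u\<in>K. \<exists>G\<in>?G. ball u r \<subseteq> G"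
    using Heine_Borel_lemma[OF K, of ?G] by metis
  have "J (u + v) \<le> J u + blinfun_apply (J' u) v + \<rho> * norm v" if uK: "u \<in> K" and v: "norm v < r" for u v
  proof -
    have "\<exists>t\<in>{0<..<1}. J (u + 1 *\<^sub>R v) - J (u + 0 *\<^sub>R v)
             = (\<lambda>s. blinfun_apply (J' (u + t *\<^sub>R v)) (s *\<^sub>R v)) (1 - 0)"
    proof (rule mvt_simple)
      show "((\<lambda>t. J (u + t *\<^sub>R v)) has_derivative (\<lambda>s. blinfun_apply (J' (u + t *\<^sub>R v)) (s *\<^sub>R v)))
              (at t within {0..1})" for t
        by (rule has_derivative_compose[OF _ deriv]) (auto intro!: derivative_eq_intros)
    qed simp
    then obtain t where t: "0 < t" "t < 1" "J (u + v) - J u = blinfun_apply (J' (u + t *\<^sub>R v)) v"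
      by auto
    have "norm (t *\<^sub>R v) \<le> norm v" using t by (simp add: mult_left_le_one_le)
    then have "norm (t *\<^sub>R v) < r" using v by simp
    obtain h where h: "ball u r \<subseteq> J' -` ball h (\<rho>/2)"
      using r(2) uK by auto
    have "u \<in> ball u r" "u + t *\<^sub>R v \<in> ball u r"
      using \<open>norm (t *\<^sub>R v) < r\<close> r by (auto simp: dist_norm)
    then have "dist h (J' u) < \<rho>/2" "dist h (J' (u + t *\<^sub>R v)) < \<rho>/2"
      using subsetD[OF h] by (simp_all only: vimage_eq mem_ball)
    then have "norm (J' (u + t *\<^sub>R v) - J' u) \<le> \<rho>"
      using dist_triangle3[of "J' (u + t *\<^sub>R v)" "J' u" h] by (simp add: dist_norm)
    then have "blinfun_apply (J' (u + t *\<^sub>R v) - J' u) v \<le> \<rho> * norm v"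
      using norm_blinfun[of "J' (u + t *\<^sub>R v) - J' u" v]
        mult_right_mono[of "norm (J' (u + t *\<^sub>R v) - J' u)" \<rho> "norm v"] by simp
    then show ?thesis using t(3) by (simp add: blinfun.diff_left)
  qed
  with r show ?thesis using that by blast
qed

section \<open>Continuous maps on a compact parameter set as a complete space\<close>

lemma continuous_on_bcontfun_eval: "continuous_on S (\<lambda>\<phi> :: 'q::topological_space \<Rightarrow>\<^sub>C 'a::metric_space. apply_bcontfun \<phi> q)"
  by (rule lipschitz_on_continuous_on[of 1]) (auto intro!: lipschitz_onI simp: dist_bounded)

lemma closed_bcontfun_eval_mem: "closed S \<Longrightarrow> closed {\<phi>. apply_bcontfun \<phi> q \<in> S}"
  using closed_vimage[OF _ continuous_on_bcontfun_eval[of UNIV q], of S] by (simp add: vimage_def)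

text \<open>Maps on the unit interval or square are encoded as maps on the whole line or plane that
  factor through a clamp \<open>c\<close>; this makes them elements of the complete space of bounded
  continuous functions.\<close>

lemma bcontfun_comp_compact:
  assumes "continuous_on UNIV c" "range c \<subseteq> K" "compact K" "continuous_on K h"
  shows "(\<lambda>q. h (c q)) \<in> bcontfun"
proof -
  have "bounded (h ` K)" using assms by (intro compact_imp_bounded compact_continuous_image)
  then have "bounded (range (\<lambda>q. h (c q)))" by (rule bounded_subset) (use assms(2) in auto)
  moreover have "continuous_on UNIV (\<lambda>q. h (c q))"
    by (rule continuous_on_compose2[OF assms(4,1,2)])
  ultimately show ?thesis by (simp add: bcontfun_def)
qed

lemma compact_range_bcontfun_retract:
  assumes "\<And>q. apply_bcontfun \<phi> q = \<phi> (c q)" "range c \<subseteq> K" "compact K"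
  shows "compact (range \<phi>)"
proof -
  have "range \<phi> = \<phi> ` K" using assms by (auto simp: image_iff)
  then show ?thesis using assms by (auto intro: compact_continuous_image)
qed

text \<open>If an Ekeland almost-minimiser had no almost fixed point of \<open>A\<close> near its
  maximal level, one small step towards \<open>A\<close> would lower \<open>I\<close> by more than
  Ekeland's principle permits. The threshold \<beta> lets the step be switched off at low levels,
  where boundary conditions may be imposed.\<close>

lemma minimax_almost_critical:
  fixes A :: "'x::banach \<Rightarrow> 'x" and \<Gamma> :: "('q::metric_space \<Rightarrow>\<^sub>C 'x) set"
  assumes deriv: "\<And>u. (J has_derivative blinfun_apply (J' u)) (at u)"
    and J'_cont: "continuous_on UNIV J'"
    and A_cont: "continuous_on UNIV A"
    and c: "c > 0" and p: "p \<ge> 1"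
    and descent: "\<And>u. blinfun_apply (J' u) (A u - u) \<le> - c * norm (u - A u) powr p"
    and \<Gamma>: "closed \<Gamma>" "\<phi>0 \<in> \<Gamma>"
    and cpt: "\<And>\<phi>. \<phi> \<in> \<Gamma> \<Longrightarrow> compact (range \<phi>)"
    and deform: "\<And>\<phi> \<psi> \<tau>. \<phi> \<in> \<Gamma> \<Longrightarrow> (\<And>u. 0 \<le> \<tau> u \<and> \<tau> u \<le> 1) \<Longrightarrow> (\<And>u. J u \<le> \<beta> \<Longrightarrow> \<tau> u = 0) \<Longrightarrow>
            (\<And>q. apply_bcontfun \<psi> q = \<phi> q + \<tau> (\<phi> q) *\<^sub>R (A (\<phi> q) - \<phi> q)) \<Longrightarrow> \<psi> \<in> \<Gamma>"
    and U: "open U"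
    and U_inv: "\<And>u t. u \<notin> U \<Longrightarrow> 0 \<le> t \<Longrightarrow> t \<le> 1 \<Longrightarrow> u + t *\<^sub>R (A u - u) \<notin> U"
    and link: "\<And>\<phi>. \<phi> \<in> \<Gamma> \<Longrightarrow> \<exists>q. \<phi> q \<in> U \<and> \<alpha> \<le> J (\<phi> q)"
    and \<beta>: "\<beta> < \<alpha>"
  shows "\<exists>b. \<forall>\<delta>>0. \<exists>\<phi>\<in>\<Gamma>. \<exists>q. \<phi> q \<in> U \<and> \<alpha> - \<delta> \<le> J (\<phi> q) \<and> J (\<phi> q) \<le> b \<and> norm (\<phi> q - A (\<phi> q)) < \<delta>"
proof -
  have J_cont: "continuous_on S J" for S
    by (meson deriv continuous_at_imp_continuous_on has_derivative_continuous)
  define I where "I \<phi> = Sup (J ` (range \<phi> \<inter> U))" for \<phi> :: "'q \<Rightarrow>\<^sub>C 'x"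
  have bddI: "bdd_above (J ` (range \<phi> \<inter> U))" if "\<phi> \<in> \<Gamma>" for \<phi>
  proof -
    have "bdd_above (J ` range \<phi>)"
      using compact_continuous_image[OF J_cont cpt[OF that]] by (intro bounded_imp_bdd_above compact_imp_bounded)
    then show ?thesis by (rule bdd_above_mono) auto
  qed
  have I_upper: "J (\<phi> q) \<le> I \<phi>" if "\<phi> \<in> \<Gamma>" "\<phi> q \<in> U" for \<phi> q
    unfolding I_def using that by (intro cSup_upper bddI) auto
  have I_le: "I \<phi> \<le> a \<longleftrightarrow> (\<forall>q. \<phi> q \<in> U \<longrightarrow> J (\<phi> q) \<le> a)" if "\<phi> \<in> \<Gamma>" for \<phi> a
  proof
    assume "\<forall>q. \<phi> q \<in> U \<longrightarrow> J (\<phi> q) \<le> a"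
    then show "I \<phi> \<le> a"
      unfolding I_def using link[OF that] by (intro cSup_least) auto
  qed (use I_upper[OF that] in force)
  have I_ge: "\<alpha> \<le> I \<phi>" if "\<phi> \<in> \<Gamma>" for \<phi>
    using link[OF that] I_upper[OF that] by force
  have lsc: "closed {\<phi>\<in>\<Gamma>. I \<phi> \<le> a}" for a
  proof -
    \<comment> \<open>Since \<open>U\<close> is open, the condition on each value
      \<open>\<phi> q\<close>, to lie outside \<open>U\<close> or at level at most \<open>a\<close>,
      is closed.\<close>
    have "{\<phi>\<in>\<Gamma>. I \<phi> \<le> a} = \<Gamma> \<inter> (\<Inter>q. (\<lambda>\<phi>. apply_bcontfun \<phi> q) -` (- U \<union> {u. J u \<le> a}))"
      using I_le by auto
    also have "closed \<dots>"
      using U J_cont by (intro closed_Int \<Gamma> closed_INT ballI closed_vimage continuous_on_bcontfun_eval)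
        (auto intro!: closed_Un closed_Collect_le)
    finally show ?thesis .
  qed
  have "\<exists>\<phi>\<in>\<Gamma>. \<exists>q. \<phi> q \<in> U \<and> \<alpha> - \<delta> \<le> J (\<phi> q) \<and> J (\<phi> q) \<le> I \<phi>0 \<and> norm (\<phi> q - A (\<phi> q)) < \<delta>"
    if "\<delta> > 0" for \<delta>
  proof -
    \<comment> \<open>At most half the gap between \<beta> and \<alpha>, so that points within
      \<delta>' of the level \<open>I \<phi>\<close> lie where the cutoff \<xi> below equals
      1.\<close>
    define \<delta>' where "\<delta>' = min \<delta> ((\<alpha> - \<beta>) / 2)"
    have \<delta>': "0 < \<delta>'" "\<delta>' \<le> \<delta>" "\<delta>' \<le> (\<alpha> - \<beta>) / 2" using that \<beta> by (auto simp: \<delta>'_def min_def)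
    \<comment> \<open>Descent per unit length at points with
      \<open>norm (u - A u) \<ge> \<delta>\<close>. One third is spent on Ekeland's penalty and one
      third on the expansion error; the last third is a strict gain.\<close>
    define \<kappa> where "\<kappa> = c * \<delta> powr (p - 1)"
    have \<kappa>: "\<kappa> > 0" using that c by (simp add: \<kappa>_def)
    obtain \<phi> where \<phi>: "\<phi> \<in> \<Gamma>" "I \<phi> \<le> I \<phi>0"
      and \<phi>_min: "\<And>\<psi>. \<psi> \<in> \<Gamma> \<Longrightarrow> I \<psi> + \<kappa>/3 * dist \<phi> \<psi> \<le> I \<phi> \<Longrightarrow> \<psi> = \<phi>"
      using Ekeland_principle[of \<Gamma> I \<alpha> \<phi>0 "\<kappa>/3"] lsc I_ge \<Gamma> \<kappa> by auto
    obtain r where r: "r > 0" and expand: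
      "\<And>u v. u \<in> range \<phi> \<Longrightarrow> norm v < r \<Longrightarrow> J (u + v) \<le> J u + blinfun_apply (J' u) v + \<kappa>/3 * norm v"
      using C1_expansion_uniform_on_compact[OF deriv J'_cont cpt[OF \<phi>(1)], of "\<kappa>/3"] \<kappa> by auto
    have "\<exists>q. \<phi> q \<in> U \<and> I \<phi> - \<delta>' \<le> J (\<phi> q) \<and> norm (\<phi> q - A (\<phi> q)) < \<delta>"
    proof (rule ccontr)
      assume "\<not> ?thesis"
      then have far: "\<delta> \<le> norm (\<phi> q - A (\<phi> q))" if "\<phi> q \<in> U" "I \<phi> - \<delta>' \<le> J (\<phi> q)" for q
        using that by force
      \<comment> \<open>The step length: below \<open>r\<close> for the expansion, at most \<delta>
        so that \<tau> stays below 1, and \<open>t * \<kappa> \<le> \<delta>'\<close> so that points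
        starting more than \<delta>' below \<open>I \<phi>\<close> stay low enough.\<close>
      define t where "t = min (r/2) (min \<delta> (\<delta>' / \<kappa>))"
      have "t \<le> r/2" "t \<le> \<delta>" "t \<le> \<delta>' / \<kappa>"
        unfolding t_def by (rule min.cobounded1 min.coboundedI2 order_refl)+
      moreover have "0 < t" using r that \<delta>' \<kappa> by (simp add: t_def)
      ultimately have t: "0 < t" "t < r" "t \<le> \<delta>" "t * \<kappa> \<le> \<delta>'"
        using r \<kappa> by (auto simp: pos_le_divide_eq)
      define \<xi> where "\<xi> u = min 1 (max 0 ((J u - \<beta>) / ((\<alpha> - \<beta>) / 2)))" for u
      \<comment> \<open>Displacements have norm at most \<open>t\<close>, and exactly
        \<open>t * \<xi> u\<close> when \<open>norm (u - A u) \<ge> \<delta>\<close>. The maximum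
        with \<delta> keeps the denominator away from 0, hence \<tau> continuous.\<close>
      define \<tau> where "\<tau> u = t * \<xi> u / max \<delta> (norm (u - A u))" for u
      have \<xi>01: "0 \<le> \<xi> u" "\<xi> u \<le> 1" for u by (auto simp: \<xi>_def)
      have \<tau>0: "0 \<le> \<tau> u" for u
        using \<xi>01[of u] t that by (auto simp: \<tau>_def intro!: divide_nonneg_pos mult_nonneg_nonneg)
      have \<tau>1: "\<tau> u \<le> 1" for u
      proof -
        have "t * \<xi> u \<le> \<delta>" using mult_mono[of t \<delta> "\<xi> u" 1] t \<xi>01[of u] that by simp
        then show ?thesis using that by (simp add: \<tau>_def divide_le_eq max_def)
      qed
      have \<tau>t: "\<tau> u * norm (A u - u) \<le> t" for u
      proof -
        have "norm (A u - u) / max \<delta> (norm (u - A u)) \<le> 1"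
          using that by (simp add: divide_le_eq norm_minus_commute max_def)
        then have "(t * \<xi> u) * (norm (A u - u) / max \<delta> (norm (u - A u))) \<le> t * 1"
          using t \<xi>01[of u] that by (intro mult_mono) (auto simp: mult_left_le max_def)
        then show ?thesis by (simp add: \<tau>_def)
      qed
      have \<tau>\<beta>: "\<tau> u = 0" if "J u \<le> \<beta>" for u
      proof -
        have "(J u - \<beta>) / ((\<alpha> - \<beta>) / 2) \<le> 0" using that \<beta> by (intro divide_nonpos_pos) auto
        then show ?thesis unfolding \<tau>_def \<xi>_def by (simp only: max_absorb1)
      qed
      define D where "D u = u + \<tau> u *\<^sub>R (A u - u)" for u
      have D_cont: "continuous_on S D" for S
      proof -
        have "continuous_on S A" using A_cont continuous_on_subset by blast
        moreover have "max \<delta> (norm (u - A u)) \<noteq> 0" for u using that by linarith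
        ultimately show ?thesis
          unfolding D_def \<tau>_def \<xi>_def using \<beta> by (intro continuous_intros J_cont) auto
      qed
      have "(\<lambda>q. D (\<phi> q)) \<in> bcontfun"
      proof -
        have "bounded (D ` range \<phi>)"
          by (intro compact_imp_bounded compact_continuous_image D_cont cpt \<phi>)
        moreover have "continuous_on UNIV (\<lambda>q. D (\<phi> q))"
          by (rule continuous_on_compose2[OF D_cont]) auto
        ultimately show ?thesis by (simp add: bcontfun_def image_image)
      qed
      then obtain \<psi> :: "'q \<Rightarrow>\<^sub>C 'x" where \<psi>: "\<And>q. \<psi> q = D (\<phi> q)"
        by (metis bcontfunE)
      have \<psi>\<Gamma>: "\<psi> \<in> \<Gamma>"
        by (rule deform[OF \<phi>(1), of \<tau>]) (use \<tau>0 \<tau>1 \<tau>\<beta> \<psi> D_def in auto)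
      have "dist \<phi> \<psi> \<le> t"
        by (rule dist_bound) (use \<tau>t \<tau>0 in \<open>simp add: \<psi> D_def dist_norm\<close>)
      have "J (\<psi> q) \<le> I \<phi> - 2/3 * (t * \<kappa>)" if "\<psi> q \<in> U" for q
      proof -
        let ?u = "\<phi> q" and ?n = "norm (\<phi> q - A (\<phi> q))"
        \<comment> \<open>A point that is in \<open>U\<close> after the step was there before, so
          its old level is controlled by \<open>I \<phi>\<close>.\<close>
        have uU: "?u \<in> U" using U_inv[of ?u "\<tau> ?u"] that \<tau>0 \<tau>1 by (auto simp: \<psi> D_def)
        have nv: "norm (\<tau> ?u *\<^sub>R (A ?u - ?u)) \<le> t" using \<tau>t \<tau>0 by simp
        then have le: "J (\<psi> q) \<le> J ?u + \<tau> ?u * blinfun_apply (J' ?u) (A ?u - ?u) + \<kappa>/3 * t"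
        proof -
          have "norm (\<tau> ?u *\<^sub>R (A ?u - ?u)) < r" using nv t by linarith
          then have "J (\<psi> q) \<le> J ?u + blinfun_apply (J' ?u) (\<tau> ?u *\<^sub>R (A ?u - ?u))
                + \<kappa>/3 * norm (\<tau> ?u *\<^sub>R (A ?u - ?u))"
            unfolding \<psi> D_def by (intro expand) auto
          also have "\<dots> \<le> J ?u + blinfun_apply (J' ?u) (\<tau> ?u *\<^sub>R (A ?u - ?u)) + \<kappa>/3 * t"
            by (intro add_left_mono mult_left_mono nv) (use \<kappa> in simp)
          finally show ?thesis by (simp add: blinfun.scaleR_right)
        qed
        have desc: "\<tau> ?u * blinfun_apply (J' ?u) (A ?u - ?u) \<le> \<tau> ?u * (- c * ?n powr p)"
          by (intro mult_left_mono descent \<tau>0)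
        show ?thesis
        proof (cases "I \<phi> - \<delta>' \<le> J ?u")
          case True
          then have n: "\<delta> \<le> ?n" using far uU by blast
          have "\<alpha> - (\<alpha> - \<beta>)/2 \<le> J ?u" using True I_ge[OF \<phi>(1)] \<delta>' by linarith
          then have "1 \<le> (J ?u - \<beta>) / ((\<alpha> - \<beta>) / 2)" using \<beta> by (simp add: field_simps)
          then have "\<tau> ?u = t / ?n" using n by (simp add: \<tau>_def \<xi>_def)
          moreover have "?n powr p = ?n * ?n powr (p - 1)"
            using n \<open>\<delta> > 0\<close> by (simp add: powr_mult_base)
          ultimately have "\<tau> ?u * (- c * ?n powr p) = - (t * (c * ?n powr (p - 1)))"
            using n \<open>\<delta> > 0\<close> by (simp add: field_simps)
          moreover have "t * \<kappa> \<le> t * (c * ?n powr (p - 1))"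
            unfolding \<kappa>_def using t c p n \<open>\<delta> > 0\<close> by (intro mult_left_mono powr_mono2) auto
          ultimately have "\<tau> ?u * (- c * ?n powr p) \<le> - (t * \<kappa>)" by linarith
          then show ?thesis using le desc I_upper[OF \<phi>(1) uU] by (simp add: mult.commute)
        next
          case False
          have "0 \<le> \<tau> ?u * (c * ?n powr p)" using \<tau>0 c by simp
          then show ?thesis using le desc t False by (simp add: mult.commute)
        qed
      qed
      then have "I \<psi> \<le> I \<phi> - 2/3 * (t * \<kappa>)" using I_le[OF \<psi>\<Gamma>] by blast
      moreover have "\<kappa>/3 * dist \<phi> \<psi> \<le> \<kappa>/3 * t"
        using \<open>dist \<phi> \<psi> \<le> t\<close> \<kappa> by simp
      moreover have "0 < t * \<kappa>" using t \<kappa> by simp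
      ultimately have "I \<psi> + \<kappa>/3 * dist \<phi> \<psi> \<le> I \<phi>" "I \<psi> < I \<phi>"
        by (simp_all add: mult.commute)
      then show False using \<phi>_min[OF \<psi>\<Gamma>] by simp
    qed
    then obtain q where q: "\<phi> q \<in> U" "I \<phi> - \<delta>' \<le> J (\<phi> q)" "norm (\<phi> q - A (\<phi> q)) < \<delta>" by blast
    have "\<alpha> - \<delta> \<le> J (\<phi> q)" using q \<delta>' I_ge[OF \<phi>(1)] by linarith
    moreover have "J (\<phi> q) \<le> I \<phi>0" using \<phi>(2) I_upper[OF \<phi>(1) q(1)] by linarith
    ultimately show ?thesis using q \<phi> by blast
  qed
  then show ?thesis by blast
qed

section \<open>Positive parts in Banach lattices\<close>

lemma pprt_add_le: "pprt (x + y) \<le> pprt x + pprt y"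
  for x y :: "'a::lattice_ab_group_add"
  unfolding pprt_def by (intro sup_least add_mono) auto

lemma inf_pprt_pprt_minus: "inf (pprt x) (pprt (- x)) = 0"
  for x :: "'a::lattice_ab_group_add"
proof -
  have "pprt x = pprt (- x) + x"
    using prts[of x] by (simp add: pprt_neg algebra_simps)
  then have "inf (pprt x) (pprt (- x)) = inf (pprt (- x) + x) (pprt (- x) + 0)"
    by simp
  also have "\<dots> = pprt (- x) + inf x 0" by (rule add_inf_distrib_left[symmetric])
  also have "\<dots> = 0" by (simp add: pprt_neg flip: nprt_def)
  finally show ?thesis .
qed

lemma pprt_diff_disjoint: "inf a b = 0 \<Longrightarrow> pprt (a - b) = a"
  for a b :: "'a::lattice_ab_group_add"
proof -
  assume "inf a b = 0"
  moreover have "pprt (a - b) = a - inf b a"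
    by (simp add: pprt_def diff_inf_eq_sup add_sup_distrib_left)
  ultimately show ?thesis by (simp add: inf_commute)
qed

text \<open>With a common bound \<open>m\<close> for both scalars, the infimum divided by
  \<open>m\<close> is a lower bound of \<open>a\<close> and \<open>b\<close>.\<close>

lemma inf_scaleR_eq_0:
  fixes a b :: "'a::{lattice_ab_group_add,ordered_real_vector}"
  assumes "inf a b = 0" "0 \<le> s" "0 \<le> t"
  shows "inf (s *\<^sub>R a) (t *\<^sub>R b) = 0"
proof (rule antisym)
  have ab: "0 \<le> a" "0 \<le> b" using assms(1) by (metis inf_le1, metis inf_le2)
  then show "0 \<le> inf (s *\<^sub>R a) (t *\<^sub>R b)" using assms by (simp add: scaleR_nonneg_nonneg)
  define m where "m = s + t + 1"
  have m: "0 < m" "s \<le> m" "t \<le> m" using assms by (auto simp: m_def)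
  have "inf (s *\<^sub>R a) (t *\<^sub>R b) \<le> m *\<^sub>R a" "inf (s *\<^sub>R a) (t *\<^sub>R b) \<le> m *\<^sub>R b"
    using m ab by (meson inf_le1 inf_le2 order_trans scaleR_right_mono)+
  then have "(1 / m) *\<^sub>R inf (s *\<^sub>R a) (t *\<^sub>R b) \<le> a" "(1 / m) *\<^sub>R inf (s *\<^sub>R a) (t *\<^sub>R b) \<le> b"
    using m scaleR_left_mono[of _ _ "1 / m"] by fastforce+
  then have "(1 / m) *\<^sub>R inf (s *\<^sub>R a) (t *\<^sub>R b) \<le> 0" using assms(1) by (metis inf_greatest)
  then have "m *\<^sub>R ((1 / m) *\<^sub>R inf (s *\<^sub>R a) (t *\<^sub>R b)) \<le> m *\<^sub>R 0"
    using m by (intro scaleR_left_mono) auto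
  then show "inf (s *\<^sub>R a) (t *\<^sub>R b) \<le> 0" using m by simp
qed

lemma disjoint_elems_diff: "inf a b = 0 \<Longrightarrow> disjoint_elems a (- b)"
  for a b :: "'a::lattice_ab_group_add"
proof -
  assume ab: "inf a b = 0"
  then have "0 \<le> a" "0 \<le> b" by (metis inf_le1, metis inf_le2)
  then show ?thesis using ab by (simp add: disjoint_elems_def modulus_def)
qed

lemma norm_mono_banach_lattice: "0 \<le> x \<Longrightarrow> x \<le> y \<Longrightarrow> norm x \<le> norm y"
  for x y :: "'e::banach_lattice"
  by (rule norm_le_if_modulus_le) simp

text \<open>The distance from \<open>x\<close> to the nonpositive cone; \<open>pnorm (- x)\<close>
  is the distance to the positive cone. It is sublinear, so its sublevel sets are convex
  neighbourhoods of a cone.\<close>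

definition pnorm :: "'e::banach_lattice \<Rightarrow> real" where
  "pnorm x = norm (pprt x)"

lemma pnorm_0 [simp]: "pnorm 0 = 0"
  by (simp add: pnorm_def)

lemma pnorm_nonneg [simp]: "0 \<le> pnorm x"
  by (simp add: pnorm_def)

lemma pnorm_eq_0_iff: "pnorm x = 0 \<longleftrightarrow> x \<le> 0"
  by (simp add: pnorm_def le_zero_iff_zero_pprt)

lemma pnorm_add_le: "pnorm (x + y) \<le> pnorm x + pnorm y"
proof -
  have "pnorm (x + y) \<le> norm (pprt x + pprt y)"
    unfolding pnorm_def by (intro norm_mono_banach_lattice pprt_add_le zero_le_pprt)
  then show ?thesis unfolding pnorm_def using norm_triangle_le by (smt (verit))
qed

lemma pnorm_le_norm: "pnorm x \<le> norm x"
  unfolding pnorm_def by (rule norm_le_if_modulus_le) simp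

lemma norm_le_pnorm_add: "norm x \<le> pnorm x + pnorm (- x)"
proof -
  have "x = pprt x - pprt (- x)" using prts[of x] by (simp add: pprt_neg)
  then show ?thesis unfolding pnorm_def by (metis norm_triangle_ineq4)
qed

lemma pnorm_scaleR: "0 \<le> t \<Longrightarrow> pnorm (t *\<^sub>R x) = t * pnorm x"
proof -
  assume t: "0 \<le> t"
  have "x = pprt x - pprt (- x)" using prts[of x] by (simp add: pprt_neg)
  then have "t *\<^sub>R x = t *\<^sub>R pprt x - t *\<^sub>R pprt (- x)"
    by (metis scaleR_right_diff_distrib)
  then have "pprt (t *\<^sub>R x) = t *\<^sub>R pprt x"
    using pprt_diff_disjoint[OF inf_scaleR_eq_0[OF inf_pprt_pprt_minus t t]] by metis
  then show ?thesis using t by (simp add: pnorm_def)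
qed

lemma pnorm_segment_le:
  assumes "pnorm x \<le> r" "pnorm y \<le> r" "0 \<le> t" "t \<le> 1"
  shows "pnorm (x + t *\<^sub>R (y - x)) \<le> r"
proof -
  have "x + t *\<^sub>R (y - x) = (1 - t) *\<^sub>R x + t *\<^sub>R y" by (simp add: algebra_simps)
  then have "pnorm (x + t *\<^sub>R (y - x)) \<le> (1 - t) * pnorm x + t * pnorm y"
    using pnorm_add_le[of "(1 - t) *\<^sub>R x" "t *\<^sub>R y"] assms by (simp add: pnorm_scaleR)
  also have "\<dots> \<le> r" using assms by (intro convex_bound_le) auto
  finally show ?thesis .
qed

lemma continuous_on_pnorm [continuous_intros]:
  assumes "continuous_on S h"
  shows "continuous_on S (\<lambda>x. pnorm (h x))"
proof -
  have "1-lipschitz_on UNIV (pnorm :: 'e::banach_lattice \<Rightarrow> real)"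
  proof (rule lipschitz_onI)
    fix x y :: 'e
    show "dist (pnorm x) (pnorm y) \<le> 1 * dist x y"
      using pnorm_add_le[of y "x - y"] pnorm_add_le[of x "y - x"]
        pnorm_le_norm[of "x - y"] pnorm_le_norm[of "y - x"]
      by (simp add: dist_real_def dist_norm abs_le_iff norm_minus_commute)
  qed simp
  then show ?thesis
    using lipschitz_on_continuous_on continuous_on_compose2[OF _ assms] by blast
qed

section \<open>The Poincare--Miranda theorem in the plane\<close>

definition clamp01 :: "real \<Rightarrow> real" where
  "clamp01 t = max 0 (min 1 t)"

lemma clamp01_bounds [simp]: "0 \<le> clamp01 t" "clamp01 t \<le> 1"
  by (auto simp: clamp01_def)

lemma clamp01_id [simp]: "0 \<le> t \<Longrightarrow> t \<le> 1 \<Longrightarrow> clamp01 t = t"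
  by (simp add: clamp01_def)

lemma continuous_on_clamp01 [continuous_intros]:
  "continuous_on S h \<Longrightarrow> continuous_on S (\<lambda>x. clamp01 (h x))"
  unfolding clamp01_def by (intro continuous_intros)

definition clamp_square :: "real \<times> real \<Rightarrow> real \<times> real" where
  "clamp_square z = (clamp01 (fst z), clamp01 (snd z))"

lemma clamp_square_simps [simp]:
  "clamp_square (clamp_square z) = clamp_square z"
  "clamp_square (s, t) = (clamp01 s, clamp01 t)"
  by (auto simp: clamp_square_def)

lemma continuous_on_clamp_square: "continuous_on S clamp_square"
  unfolding clamp_square_def by (intro continuous_intros)

lemma range_clamp_square: "range clamp_square \<subseteq> {0..1} \<times> {0..1}"
  by (auto simp: clamp_square_def)

text \<open>A fixed point of the clamped step with nonzero \<open>h\<close> sits at an endpoint and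
  is pushed outward; the sign conditions exclude this.\<close>

lemma clamp01_fixed_imp_0:
  assumes "clamp01 (s - h) = s" "s = 0 \<Longrightarrow> h \<le> 0" "s = 1 \<Longrightarrow> h \<ge> 0"
  shows "h = 0"
  using assms by (auto simp: clamp01_def min_def max_def split: if_splits)

text \<open>Brouwer's theorem for the step by \<open>- (h, k)\<close> clamped back to the square;
  the boundary signs turn its fixed point into a common zero.\<close>

lemma Poincare_Miranda_plane:
  fixes h k :: "real \<times> real \<Rightarrow> real"
  assumes cont: "continuous_on (cbox (0, 0) (1, 1)) h" "continuous_on (cbox (0, 0) (1, 1)) k"
    and h: "\<And>t. 0 \<le> t \<Longrightarrow> t \<le> 1 \<Longrightarrow> h (0, t) \<le> 0 \<and> h (1, t) \<ge> 0"
    and k: "\<And>s. 0 \<le> s \<Longrightarrow> s \<le> 1 \<Longrightarrow> k (s, 0) \<le> 0 \<and> k (s, 1) \<ge> 0"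
  shows "\<exists>z\<in>cbox (0, 0) (1, 1). h z = 0 \<and> k z = 0"
proof -
  let ?Q = "cbox (0, 0) (1, 1) :: (real \<times> real) set"
  let ?\<Phi> = "\<lambda>z. (clamp01 (fst z - h z), clamp01 (snd z - k z))"
  obtain z where z: "z \<in> ?Q" "?\<Phi> z = z"
  proof (rule brouwer[of ?Q ?\<Phi>])
    show "continuous_on ?Q ?\<Phi>" using cont by (intro continuous_intros)
    show "?\<Phi> \<in> ?Q \<rightarrow> ?Q" by (auto simp: cbox_Pair_eq)
  qed (auto simp: convex_box simp del: cbox_Pair_eq, auto simp: cbox_Pair_eq)
  obtain s t where st: "z = (s, t)" by fastforce
  then have bounds: "0 \<le> s" "s \<le> 1" "0 \<le> t" "t \<le> 1" using z by (auto simp: cbox_Pair_eq)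
  have "h z = 0" by (rule clamp01_fixed_imp_0[of s]) (use z st h bounds in auto)
  moreover have "k z = 0" by (rule clamp01_fixed_imp_0[of t]) (use z st k bounds in auto)
  ultimately show ?thesis using z by blast
qed

section \<open>The operator equation\<close>

locale superlinear_problem =
  fixes \<iota> :: "'x::banach \<Rightarrow> 'e::banach_lattice"
    and J :: "'x \<Rightarrow> real"
    and J' :: "'x \<Rightarrow> 'x \<Rightarrow>\<^sub>L real"
    and T :: "'x \<Rightarrow> 'x \<Rightarrow>\<^sub>L real"
    and f :: "'e \<Rightarrow> 'e \<Rightarrow>\<^sub>L real"
    and p c1 :: real
    and g :: "real \<Rightarrow> real"
  assumes reflX: "reflexive_space TYPE('x)"
    and emb: "compact_embedding \<iota>"
    and parts: "\<And>u. pprt (\<iota> u) \<in> range \<iota> \<and> - pprt (- \<iota> u) \<in> range \<iota>"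
    and T0: "T 0 = 0"
    and J_deriv: "\<And>u. (J has_derivative blinfun_apply (J' u)) (at u)"
    and J'_cont: "continuous_on UNIV J'"
    and J'_eq: "\<And>u v. blinfun_apply (J' u) v =
                  blinfun_apply (T u) v - blinfun_apply (f (\<iota> u)) (\<iota> v)"
    and f_cont: "continuous_on UNIV f"
    and T_cont: "continuous_on UNIV T"
    and T_plus: "\<And>u. blinfun_apply (T u) (plus_part \<iota> u) =
                  blinfun_apply (T (plus_part \<iota> u)) (plus_part \<iota> u)"
    and T_minus: "\<And>u. blinfun_apply (T u) (minus_part \<iota> u) =
                  blinfun_apply (T (minus_part \<iota> u)) (minus_part \<iota> u)"
    and c1: "c1 > 0"
    and p: "p \<ge> 2"
    and T_mono: "\<And>u v. blinfun_apply (T u - T v) (u - v) \<ge> c1 * norm (u - v) powr p"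
    and f_orth: "orthogonally_additive f"
    and f_pos: "\<And>u. u \<in> cone_in \<iota> \<Longrightarrow> f (\<iota> u) \<in> dual_cone"
    and f_neg: "\<And>u. - u \<in> cone_in \<iota> \<Longrightarrow> - f (\<iota> u) \<in> dual_cone"
    and f_bound: "\<And>u w. blinfun_apply (f (\<iota> u)) (\<iota> w) \<le> g (norm (\<iota> u)) * norm (\<iota> w)"
    and g_lim: "((\<lambda>s. g s / s powr (p - 1)) \<longlongrightarrow> 0) (at_right 0)"
    and J_lim: "\<And>u. u \<noteq> 0 \<Longrightarrow> filterlim (\<lambda>t. J (t *\<^sub>R u)) at_bot at_top"
    and PS: "\<And>(u :: nat \<Rightarrow> 'x) a b.
               (\<And>n. J (u n) \<in> {a..b}) \<Longrightarrow>
               (\<lambda>n. norm (u n - sol_op \<iota> T f (u n))) \<longlonglongrightarrow> 0 \<Longrightarrow>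
               bounded (range u) \<and> (\<lambda>n. J' (u n)) \<longlonglongrightarrow> 0"
begin

lemma bounded_linear_\<iota>: "bounded_linear \<iota>"
  using emb by (simp add: compact_embedding_def)

lemma inj_\<iota>: "inj \<iota>"
  using emb by (simp add: compact_embedding_def)

sublocale \<iota>: bounded_linear \<iota>
  by (rule bounded_linear_\<iota>)

lemma \<iota>_eq_iff [simp]: "\<iota> u = \<iota> v \<longleftrightarrow> u = v"
  using inj_\<iota> by (simp add: inj_eq)

lemma \<iota>_eq_0_iff [simp]: "\<iota> u = 0 \<longleftrightarrow> u = 0"
  using \<iota>_eq_iff[of u 0] by (simp add: \<iota>.zero)

lemma continuous_on_\<iota> [continuous_intros]: "continuous_on S h \<Longrightarrow> continuous_on S (\<lambda>x. \<iota> (h x))"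
  by (rule \<iota>.continuous_on)

lemma \<iota>_plus_part: "\<iota> (plus_part \<iota> u) = pprt (\<iota> u)"
  unfolding plus_part_def using parts by (metis f_inv_into_f)

lemma \<iota>_minus_part: "\<iota> (minus_part \<iota> u) = - pprt (- \<iota> u)"
  unfolding minus_part_def using parts by (metis f_inv_into_f)

lemma plus_part_eqI: "\<iota> v = pprt (\<iota> u) \<Longrightarrow> plus_part \<iota> u = v"
  using \<iota>_plus_part \<iota>_eq_iff by metis

lemma minus_part_eqI: "\<iota> v = - pprt (- \<iota> u) \<Longrightarrow> minus_part \<iota> u = v"
  using \<iota>_minus_part \<iota>_eq_iff by metis

lemma f_disjoint_add:
  assumes "inf a b = 0"
  shows "f (a - b) = f a + f (- b)"
  using f_orth disjoint_elems_diff[OF assms] unfolding orthogonally_additive_def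
  by (metis diff_conv_add_uminus)

lemma f_0 [simp]: "f 0 = 0"
  using f_disjoint_add[of 0 0] by simp

lemma f_split: "f (\<iota> u) = f (\<iota> (plus_part \<iota> u)) + f (\<iota> (minus_part \<iota> u))"
  using f_disjoint_add[OF inf_pprt_pprt_minus, of "\<iota> u"] prts[of "\<iota> u"]
  by (simp add: \<iota>_plus_part \<iota>_minus_part pprt_neg)

lemma f_nonneg: "0 \<le> \<iota> u \<Longrightarrow> 0 \<le> \<iota> w \<Longrightarrow> 0 \<le> blinfun_apply (f (\<iota> u)) (\<iota> w)"
  using f_pos[of u] by (auto simp: cone_in_def pos_cone_def dual_cone_def)

lemma f_nonpos: "\<iota> u \<le> 0 \<Longrightarrow> 0 \<le> \<iota> w \<Longrightarrow> blinfun_apply (f (\<iota> u)) (\<iota> w) \<le> 0"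
  using f_neg[of u] by (auto simp: cone_in_def pos_cone_def dual_cone_def \<iota>.neg blinfun.minus_left)

subsection \<open>The solution operator\<close>

text \<open>Restricts functionals on \<open>E\<close> to \<open>X\<close> along \<iota>, so that the
  equation reads \<open>T u = F u\<close> in the dual of \<open>X\<close>.\<close>

definition F :: "'x \<Rightarrow> 'x \<Rightarrow>\<^sub>L real" where
  "F u = f (\<iota> u) o\<^sub>L Blinfun \<iota>"

abbreviation A :: "'x \<Rightarrow> 'x" where "A \<equiv> sol_op \<iota> T f"

lemma F_apply: "blinfun_apply (F u) w = blinfun_apply (f (\<iota> u)) (\<iota> w)"
  by (simp add: F_def bounded_linear_Blinfun_apply[OF bounded_linear_\<iota>])

lemma J'_F: "J' u = T u - F u"
  by (rule blinfun_eqI) (simp add: J'_eq F_apply blinfun.diff_left)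

lemma F_cont: "continuous_on S F"
proof -
  have "continuous_on S (\<lambda>u. f (\<iota> u))"
    by (rule continuous_on_compose2[OF f_cont]) (auto intro!: continuous_intros)
  then show ?thesis unfolding F_def by (intro continuous_intros)
qed

lemma T_coercive: "c1 * norm u powr p \<le> blinfun_apply (T u) u"
  using T_mono[of u 0] T0 by simp

text \<open>Strong monotonicity makes the inverse of \<open>T\<close> Hoelder continuous, since
  \<open>c1 * norm (u - v) powr (p - 1)\<close> is at most \<open>norm (T u - T v)\<close>. This
  form serves continuity of \<open>A\<close> as well as Cauchy sequences.\<close>

lemma T_dist_imp_dist:
  assumes "norm (T u - T v) < c1 * e powr (p - 1)" "0 < e"
  shows "norm (u - v) < e"
proof (rule ccontr)
  assume "\<not> norm (u - v) < e"
  then have e: "e \<le> norm (u - v)" "0 < norm (u - v)" using assms(2) by auto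
  have "c1 * (norm (u - v) * e powr (p - 1)) \<le> c1 * (norm (u - v) * norm (u - v) powr (p - 1))"
    using c1 p e assms(2) by (intro mult_left_mono powr_mono2) auto
  also have "\<dots> = c1 * norm (u - v) powr p"
    using e by (simp add: powr_mult_base)
  also have "\<dots> \<le> norm (T u - T v) * norm (u - v)"
    using T_mono[of u v] norm_blinfun[of "T u - T v" "u - v"] by simp
  finally have "(c1 * e powr (p - 1)) * norm (u - v) \<le> norm (T u - T v) * norm (u - v)"
    by (simp add: algebra_simps)
  then show False using assms(1) e by simp
qed

lemma T_inj: "T u = T v \<Longrightarrow> u = v"
  using T_mono[of u v] c1 by (simp add: mult_le_0_iff)

lemma T_surj: "\<exists>v. T v = h"
proof (rule Browder_Minty[OF reflX T_cont])
  \<comment> \<open>\<open>1 \<le> r\<close> allows the exponent 2 to be raised to \<open>p\<close>,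
    and \<open>norm h < c1 * r\<close> makes the coercive term win on the sphere.\<close>
  define r where "r = max 1 (norm h / c1 + 1)"
  have r: "1 \<le> r" "norm h < c1 * r"
    using c1 by (auto simp: r_def max_def field_simps)
  then show "0 < r" by simp
  show "0 \<le> blinfun_apply (T u - T v) (u - v)" for u v
    using T_mono[of u v] c1 by (smt (verit) mult_nonneg_nonneg powr_ge_zero)
  show "blinfun_apply h u < blinfun_apply (T u) u" if "norm u = r" for u
  proof -
    have "blinfun_apply h u \<le> norm h * r" using norm_blinfun[of h u] that by simp
    also have "\<dots> < (c1 * r) * r" using r by (intro mult_strict_right_mono) auto
    also have "\<dots> = c1 * r powr 2" using r by (simp add: power2_eq_square)
    also have "\<dots> \<le> c1 * r powr p" using r p c1 by (intro mult_left_mono powr_mono) auto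
    also have "\<dots> \<le> blinfun_apply (T u) u" using T_coercive[of u] that by simp
    finally show ?thesis .
  qed
qed

lemma T_A: "T (A u) = F u"
proof -
  obtain v where v: "T v = F u" using T_surj by blast
  have "A u = v"
    unfolding sol_op_def
  proof (rule the_equality)
    show "\<forall>w. blinfun_apply (T v) w = blinfun_apply (f (\<iota> u)) (\<iota> w)" by (simp add: v F_apply)
    fix v' assume "\<forall>w. blinfun_apply (T v') w = blinfun_apply (f (\<iota> u)) (\<iota> w)"
    then have "T v' = T v" unfolding v by (intro blinfun_eqI) (simp add: F_apply)
    then show "v' = v" by (rule T_inj)
  qed
  then show ?thesis using v by simp
qed

lemma A_cont: "continuous_on UNIV A"
  unfolding continuous_on_iff
proof (intro ballI allI impI)
  fix u :: 'x and e :: real assume "0 < e"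
  then have "0 < c1 * e powr (p - 1)" using c1 by simp
  then obtain d where "d > 0" "\<And>v. dist v u < d \<Longrightarrow> dist (F v) (F u) < c1 * e powr (p - 1)"
    using F_cont[of UNIV] unfolding continuous_on_iff by (metis UNIV_I)
  then have "dist (A v) (A u) < e" if "dist v u < d" for v
    using T_dist_imp_dist[of "A v" "A u" e] \<open>0 < e\<close> that by (simp add: T_A dist_norm)
  with \<open>d > 0\<close> show "\<exists>d>0. \<forall>v\<in>UNIV. dist v u < d \<longrightarrow> dist (A v) (A u) < e" by blast
qed

lemma A_0: "A 0 = 0"
  by (rule T_inj) (simp add: T_A T0 F_def \<iota>.zero)

text \<open>Because \<open>T (A u) = F u\<close>, the derivative is \<open>T u - T (A u)\<close>,
  and strong monotonicity applies.\<close>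

lemma J'_descent: "blinfun_apply (J' u) (A u - u) \<le> - c1 * norm (u - A u) powr p"
proof -
  have "blinfun_apply (J' u) (A u - u) = - blinfun_apply (T u - T (A u)) (u - A u)"
    by (simp add: J'_F T_A blinfun.bilinear_simps)
  then show ?thesis using T_mono[of u "A u"] by simp
qed

lemma is_solution_iff: "is_solution \<iota> T f u \<longleftrightarrow> J' u = 0"
  unfolding is_solution_def using J'_eq[of u] by (auto intro!: blinfun_eqI)

section \<open>Convergence of almost critical sequences\<close>

text \<open>Boundedness and the compact embedding make \<open>\<iota> (u n)\<close> converge along a
  subsequence, hence \<open>F (u n)\<close>, hence \<open>T (u n)\<close> as the sum of
  \<open>J'\<close> and \<open>F\<close>; the inverse estimate for \<open>T\<close> carries this
  back to \<open>X\<close>.\<close>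

lemma PS_convergent:
  assumes "\<And>n. J (u n) \<in> {a..b}" "(\<lambda>n. norm (u n - A (u n))) \<longlonglongrightarrow> 0"
  obtains l r where "strict_mono r" "(u \<circ> r) \<longlonglongrightarrow> l" "J' l = 0"
proof -
  have bdd: "bounded (range u)" and J'0: "(\<lambda>n. J' (u n)) \<longlonglongrightarrow> 0"
    using PS[OF assms] by auto
  have "compact (closure (\<iota> ` range u))"
    using emb bdd by (simp add: compact_embedding_def)
  moreover have "\<forall>n. \<iota> (u n) \<in> closure (\<iota> ` range u)"
    by (auto intro: closure_subset[THEN subsetD])
  ultimately obtain y r where r: "strict_mono r" and y: "((\<lambda>n. \<iota> (u n)) \<circ> r) \<longlonglongrightarrow> y"
    unfolding compact_def by metis
  have "(\<lambda>n. f (\<iota> (u (r n)))) \<longlonglongrightarrow> f y"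
    using continuous_on_tendsto_compose[OF f_cont y] by (simp add: o_def)
  then have "(\<lambda>n. F (u (r n))) \<longlonglongrightarrow> (f y o\<^sub>L Blinfun \<iota>)"
    unfolding F_def by (intro tendsto_intros)
  moreover have J'0r: "(\<lambda>n. J' (u (r n))) \<longlonglongrightarrow> 0"
    using LIMSEQ_subseq_LIMSEQ[OF J'0 r] by (simp add: o_def)
  ultimately have "(\<lambda>n. J' (u (r n)) + F (u (r n))) \<longlonglongrightarrow> 0 + (f y o\<^sub>L Blinfun \<iota>)"
    by (intro tendsto_intros)
  then have CT: "Cauchy (\<lambda>n. T (u (r n)))"
    using LIMSEQ_imp_Cauchy by (simp add: J'_F)
  have "Cauchy (u \<circ> r)"
    unfolding Cauchy_def
  proof (intro allI impI)
    fix e :: real assume "0 < e"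
    then have "0 < c1 * e powr (p - 1)" using c1 by simp
    then obtain M where "\<And>m n. m \<ge> M \<Longrightarrow> n \<ge> M \<Longrightarrow> dist (T (u (r m))) (T (u (r n))) < c1 * e powr (p - 1)"
      using CT unfolding Cauchy_def by metis
    then show "\<exists>M. \<forall>m\<ge>M. \<forall>n\<ge>M. dist ((u \<circ> r) m) ((u \<circ> r) n) < e"
      using T_dist_imp_dist \<open>0 < e\<close> by (auto simp: dist_norm intro!: exI[of _ M])
  qed
  then obtain l where l: "(u \<circ> r) \<longlonglongrightarrow> l"
    using Cauchy_convergent convergent_def by blast
  have "(\<lambda>n. J' (u (r n))) \<longlonglongrightarrow> J' l"
    using continuous_on_tendsto_compose[OF J'_cont l] by (simp add: o_def)
  then have "J' l = 0" using J'0r LIMSEQ_unique by blast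
  then show ?thesis using that r l by blast
qed

lemma J_cont: "continuous_on S J"
  by (meson J_deriv continuous_at_imp_continuous_on has_derivative_continuous)

text \<open>Besides the level bound, the closure condition locates the critical point; it is what
  later decides its sign.\<close>

lemma minimax_critical_point:
  fixes \<Gamma> :: "('q::metric_space \<Rightarrow>\<^sub>C 'x) set"
  assumes \<Gamma>: "closed \<Gamma>" "\<phi>0 \<in> \<Gamma>"
    and cpt: "\<And>\<phi>. \<phi> \<in> \<Gamma> \<Longrightarrow> compact (range \<phi>)"
    and deform: "\<And>\<phi> \<psi> \<tau>. \<phi> \<in> \<Gamma> \<Longrightarrow> (\<And>u. 0 \<le> \<tau> u \<and> \<tau> u \<le> 1) \<Longrightarrow> (\<And>u. J u \<le> \<beta> \<Longrightarrow> \<tau> u = 0) \<Longrightarrow>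
            (\<And>q. apply_bcontfun \<psi> q = \<phi> q + \<tau> (\<phi> q) *\<^sub>R (A (\<phi> q) - \<phi> q)) \<Longrightarrow> \<psi> \<in> \<Gamma>"
    and U: "open U"
    and U_inv: "\<And>u t. u \<notin> U \<Longrightarrow> 0 \<le> t \<Longrightarrow> t \<le> 1 \<Longrightarrow> u + t *\<^sub>R (A u - u) \<notin> U"
    and link: "\<And>\<phi>. \<phi> \<in> \<Gamma> \<Longrightarrow> \<exists>q. \<phi> q \<in> U \<and> \<alpha> \<le> J (\<phi> q)"
    and \<beta>: "\<beta> < \<alpha>"
  obtains l where "J' l = 0" "\<alpha> \<le> J l" "l \<in> closure {apply_bcontfun \<phi> q |\<phi> q. \<phi> \<in> \<Gamma> \<and> apply_bcontfun \<phi> q \<in> U}"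
proof -
  have "\<exists>b. \<forall>\<delta>>0. \<exists>\<phi>\<in>\<Gamma>. \<exists>q. apply_bcontfun \<phi> q \<in> U \<and> \<alpha> - \<delta> \<le> J (\<phi> q) \<and> J (\<phi> q) \<le> b \<and> norm (\<phi> q - A (\<phi> q)) < \<delta>"
    by (rule minimax_almost_critical[OF J_deriv J'_cont A_cont c1 _ J'_descent \<Gamma> cpt deform U U_inv link \<beta>])
      (use p in auto)
  then obtain b where b: "\<And>\<delta>. \<delta> > 0 \<Longrightarrow> \<exists>\<phi>\<in>\<Gamma>. \<exists>q. \<phi> q \<in> U \<and> \<alpha> - \<delta> \<le> J (\<phi> q) \<and> J (\<phi> q) \<le> b \<and> norm (\<phi> q - A (\<phi> q)) < \<delta>"
    by blast
  define W where "W = {apply_bcontfun \<phi> q |\<phi> q. \<phi> \<in> \<Gamma> \<and> apply_bcontfun \<phi> q \<in> U}"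
  have "\<exists>w. w \<in> W \<and> \<alpha> - 1 / Suc n \<le> J w \<and> J w \<le> b \<and> norm (w - A w) < 1 / Suc n" for n
    using b[of "1 / Suc n"] unfolding W_def by fastforce
  then have "\<exists>w. \<forall>n. w n \<in> W \<and> \<alpha> - 1 / Suc n \<le> J (w n) \<and> J (w n) \<le> b \<and> norm (w n - A (w n)) < 1 / Suc n"
    by (intro choice allI)
  then obtain w where wW: "\<And>n. w n \<in> W" and wJ: "\<And>n. \<alpha> - 1 / Suc n \<le> J (w n)"
    and wb: "\<And>n. J (w n) \<le> b" and wA: "\<And>n. norm (w n - A (w n)) < 1 / Suc n"
    by blast
  have "J (w n) \<in> {\<alpha> - 1..b}" for n
  proof -
    have "1 / real (Suc n) \<le> 1" by simp
    then show ?thesis using wJ[of n] wb[of n] unfolding atLeastAtMost_iff by linarith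
  qed
  moreover have lim0: "(\<lambda>n. 1 / real (Suc n)) \<longlonglongrightarrow> 0"
    using LIMSEQ_inverse_real_of_nat by (simp add: inverse_eq_divide)
  have "(\<lambda>n. norm (w n - A (w n))) \<longlonglongrightarrow> 0"
    by (rule tendsto_sandwich[OF _ _ tendsto_const lim0]) (use wA in \<open>auto intro!: always_eventually less_imp_le\<close>)
  ultimately obtain l r where r: "strict_mono r" and l: "(w \<circ> r) \<longlonglongrightarrow> l" "J' l = 0"
    using PS_convergent by metis
  show ?thesis
  proof
    show "J' l = 0" by (rule l)
    have "(\<lambda>n. J (w (r n))) \<longlonglongrightarrow> J l"
      using continuous_on_tendsto_compose[OF J_cont[of UNIV] l(1)] by (simp add: o_def)
    moreover have "(\<lambda>n. \<alpha> - 1 / real (Suc (r n))) \<longlonglongrightarrow> \<alpha> - 0"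
      using LIMSEQ_subseq_LIMSEQ[OF lim0 r] by (intro tendsto_intros) (simp add: o_def)
    ultimately show "\<alpha> \<le> J l"
      using wJ by (intro LIMSEQ_le[of "\<lambda>n. \<alpha> - 1 / real (Suc (r n))" \<alpha>]) auto
    have "l \<in> closure W"
      unfolding closure_sequential using l(1) wW by (intro exI[of _ "w \<circ> r"]) simp
    then show "l \<in> closure {apply_bcontfun \<phi> q |\<phi> q. \<phi> \<in> \<Gamma> \<and> apply_bcontfun \<phi> q \<in> U}"
      by (simp only: W_def)
  qed
qed

subsection \<open>Behaviour near the cones and near zero\<close>

text \<open>A pair of constants at which \<open>T\<close> dominates \<open>f\<close>: the factor 2
  leaves half of the coercivity after the nonlinearity is absorbed, for arguments of
  \<open>E\<close>-norm at most \<open>e\<close>.\<close>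

definition small_scale :: "real \<Rightarrow> real \<Rightarrow> bool" where
  "small_scale \<kappa> e \<longleftrightarrow> 0 < \<kappa> \<and> 0 < e \<and> (\<forall>u. 2 * \<kappa> * norm (\<iota> u) powr p \<le> c1 * norm u powr p)
     \<and> (\<forall>s. 0 < s \<longrightarrow> s \<le> e \<longrightarrow> g s \<le> \<kappa> * s powr (p - 1))"

lemma g_small:
  assumes "0 < \<eta>"
  obtains e where "0 < e" "\<And>s. 0 < s \<Longrightarrow> s \<le> e \<Longrightarrow> g s \<le> \<eta> * s powr (p - 1)"
proof -
  have "\<forall>\<^sub>F s in at_right 0. g s / s powr (p - 1) < \<eta>"
    using g_lim assms by (rule order_tendstoD)
  then obtain e where e: "0 < e" "\<And>s. 0 < s \<Longrightarrow> s < e \<Longrightarrow> g s / s powr (p - 1) < \<eta>"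
    unfolding eventually_at_right_field by auto
  show ?thesis
  proof (rule that[of "e / 2"])
    fix s assume "0 < s" "s \<le> e / 2"
    then have "g s / s powr (p - 1) < \<eta>" using e by auto
    then show "g s \<le> \<eta> * s powr (p - 1)" using \<open>0 < s\<close> by (simp add: divide_less_eq)
  qed (use e in simp)
qed

lemma small_scale_exists: "\<exists>\<kappa> e. small_scale \<kappa> e"
proof -
  obtain c0 where c0: "0 < c0" "\<And>u. norm (\<iota> u) \<le> norm u * c0"
    using \<iota>.pos_bounded by auto
  \<comment> \<open>Turns the embedding inequality with constant \<open>c0\<close> into the first
    clause of \<open>small_scale\<close>.\<close>
  define \<kappa> where "\<kappa> = c1 / (2 * c0 powr p)"
  have \<kappa>: "0 < \<kappa>" using c1 c0 by (simp add: \<kappa>_def)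
  have "2 * \<kappa> * norm (\<iota> u) powr p \<le> c1 * norm u powr p" for u
  proof -
    have "norm (\<iota> u) powr p \<le> (norm u * c0) powr p"
      using c0 p by (intro powr_mono2) auto
    then have "2 * \<kappa> * norm (\<iota> u) powr p \<le> 2 * \<kappa> * (norm u powr p * c0 powr p)"
      using \<kappa> c0 by (intro mult_left_mono) (auto simp: powr_mult)
    also have "\<dots> = c1 * norm u powr p" using c0 by (simp add: \<kappa>_def)
    finally show ?thesis .
  qed
  moreover obtain e where "0 < e" "\<And>s. 0 < s \<Longrightarrow> s \<le> e \<Longrightarrow> g s \<le> \<kappa> * s powr (p - 1)"
    using g_small[OF \<kappa>] by blast
  ultimately show ?thesis using \<kappa> unfolding small_scale_def by blast
qed

text \<open>If \<open>\<iota> w\<close> were larger than \<open>\<iota> a\<close>, coercivity and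
  the growth bound would give \<open>2 * \<kappa> * norm (\<iota> w) powr p\<close> at most half of
  itself.\<close>

lemma norm_part_le:
  assumes small: "small_scale \<kappa> e"
    and le: "blinfun_apply (T w) w \<le> blinfun_apply (f (\<iota> a)) (\<iota> w)"
    and a: "norm (\<iota> a) \<le> e"
  shows "norm (\<iota> w) \<le> norm (\<iota> a)"
proof (rule ccontr)
  assume "\<not> ?thesis"
  then have n: "norm (\<iota> a) < norm (\<iota> w)" by simp
  then have w: "0 < norm (\<iota> w)" by (rule le_less_trans[OF norm_ge_zero])
  have \<kappa>: "0 < \<kappa>" using small by (simp add: small_scale_def)
  have "2 * \<kappa> * norm (\<iota> w) powr p \<le> c1 * norm w powr p"
    using small by (simp add: small_scale_def)
  also have "\<dots> \<le> blinfun_apply (f (\<iota> a)) (\<iota> w)" using T_coercive le by (rule order_trans)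
  also have "\<dots> \<le> \<kappa> * norm (\<iota> a) powr (p - 1) * norm (\<iota> w)"
  \<comment> \<open>The growth bound is available for positive norms only; at 0 the value
    \<open>f 0 = 0\<close> is used.\<close>
  proof (cases "a = 0")
    case True
    then show ?thesis by (simp add: \<iota>.zero)
  next
    case False
    then have "g (norm (\<iota> a)) \<le> \<kappa> * norm (\<iota> a) powr (p - 1)"
      using small a by (simp add: small_scale_def)
    then have "g (norm (\<iota> a)) * norm (\<iota> w) \<le> \<kappa> * norm (\<iota> a) powr (p - 1) * norm (\<iota> w)"
      by (intro mult_right_mono) auto
    then show ?thesis using f_bound[of a w] by linarith
  qed
  also have "\<dots> \<le> \<kappa> * norm (\<iota> w) powr (p - 1) * norm (\<iota> w)"
    using n p \<kappa> by (intro mult_right_mono mult_left_mono powr_mono2) auto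
  also have "\<dots> = \<kappa> * norm (\<iota> w) powr p"
    using w powr_mult_base[of "norm (\<iota> w)" "p - 1"] by (simp add: mult.commute mult.left_commute)
  finally have "\<kappa> * norm (\<iota> w) powr p \<le> 0" by simp
  moreover have "0 < \<kappa> * norm (\<iota> w) powr p" using w \<kappa> by simp
  ultimately show False by linarith
qed

text \<open>Test \<open>T (A u) = F u\<close> with the positive part of \<open>A u\<close>.
  \<open>T_plus\<close> leaves only that part inside \<open>T\<close>; orthogonal additivity splits
  \<open>f\<close>, and the summand from the negative part of \<open>u\<close> has the favourable
  sign.\<close>

lemma pnorm_A_le:
  assumes "small_scale \<kappa> e" "pnorm (\<iota> u) \<le> e"
  shows "pnorm (\<iota> (A u)) \<le> pnorm (\<iota> u)"
proof -
  let ?w = "plus_part \<iota> (A u)" and ?a = "plus_part \<iota> u"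
  have "blinfun_apply (T ?w) ?w = blinfun_apply (f (\<iota> u)) (\<iota> ?w)"
    by (metis T_plus T_A F_apply)
  also have "\<dots> = blinfun_apply (f (\<iota> ?a)) (\<iota> ?w) + blinfun_apply (f (\<iota> (minus_part \<iota> u))) (\<iota> ?w)"
    by (subst f_split) (rule blinfun.add_left)
  also have "\<dots> \<le> blinfun_apply (f (\<iota> ?a)) (\<iota> ?w)"
    using f_nonpos[of "minus_part \<iota> u" ?w] by (simp add: \<iota>_minus_part \<iota>_plus_part)
  finally show ?thesis
    using norm_part_le[OF assms(1), of ?w ?a] assms(2) by (simp add: \<iota>_plus_part pnorm_def)
qed

lemma pnorm_minus_A_le:
  assumes "small_scale \<kappa> e" "pnorm (- \<iota> u) \<le> e"
  shows "pnorm (- \<iota> (A u)) \<le> pnorm (- \<iota> u)"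
proof -
  let ?w = "minus_part \<iota> (A u)" and ?a = "minus_part \<iota> u"
  have "blinfun_apply (T ?w) ?w = blinfun_apply (f (\<iota> u)) (\<iota> ?w)"
    by (metis T_minus T_A F_apply)
  also have "\<dots> = blinfun_apply (f (\<iota> (plus_part \<iota> u))) (\<iota> ?w) + blinfun_apply (f (\<iota> ?a)) (\<iota> ?w)"
    by (subst f_split) (rule blinfun.add_left)
  also have "\<dots> \<le> blinfun_apply (f (\<iota> ?a)) (\<iota> ?w)"
    using f_nonneg[of "plus_part \<iota> u" "- ?w"]
    by (simp add: \<iota>_minus_part \<iota>_plus_part \<iota>.neg blinfun.minus_right)
  finally show ?thesis
    using norm_part_le[OF assms(1), of ?w ?a] assms(2) by (simp add: \<iota>_minus_part pnorm_def)
qed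

text \<open>With \<open>r = 0\<close> this is invariance of a cone, with \<open>r > 0\<close>
  invariance of its neighbourhood.\<close>

lemma pnorm_A_segment_le:
  assumes "small_scale \<kappa> e" "pnorm (\<iota> u) \<le> r" "r \<le> e" "0 \<le> t" "t \<le> 1"
  shows "pnorm (\<iota> (u + t *\<^sub>R (A u - u))) \<le> r"
  using pnorm_segment_le[of "\<iota> u" r "\<iota> (A u)" t] pnorm_A_le[OF assms(1), of u] assms
  by (simp add: \<iota>.add \<iota>.diff \<iota>.scaleR)

lemma pnorm_minus_A_segment_le:
  assumes "small_scale \<kappa> e" "pnorm (- \<iota> u) \<le> r" "r \<le> e" "0 \<le> t" "t \<le> 1"
  shows "pnorm (- \<iota> (u + t *\<^sub>R (A u - u))) \<le> r"
proof -
  have "- \<iota> (u + t *\<^sub>R (A u - u)) = - \<iota> u + t *\<^sub>R (- \<iota> (A u) - - \<iota> u)"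
    by (simp add: \<iota>.add \<iota>.diff \<iota>.scaleR algebra_simps)
  then show ?thesis
    using pnorm_segment_le[of "- \<iota> u" r "- \<iota> (A u)" t] pnorm_minus_A_le[OF assms(1), of u] assms
    by simp
qed

lemma J_line_derivative:
  "((\<lambda>s. J (s *\<^sub>R a + w)) has_real_derivative blinfun_apply (J' (s *\<^sub>R a + w)) a) (at s)"
proof -
  have "((\<lambda>s. J (s *\<^sub>R a + w)) has_derivative (\<lambda>h. blinfun_apply (J' (s *\<^sub>R a + w)) (h *\<^sub>R a))) (at s)"
    by (rule has_derivative_compose[OF _ J_deriv]) (auto intro!: derivative_eq_intros)
  then show ?thesis
    unfolding has_field_derivative_def
    by (rule has_derivative_eq_rhs) (simp add: fun_eq_iff blinfun.scaleR_right mult.commute)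
qed

lemma continuous_on_J [continuous_intros]: "continuous_on S h \<Longrightarrow> continuous_on S (\<lambda>x. J (h x))"
  by (rule continuous_on_compose2[OF J_cont]) auto

text \<open>Along the ray through \<open>u\<close>, coercivity contributes
  \<open>2 * \<kappa> * n powr p * t powr (p - 1)\<close> to the derivative and \<open>f\<close>
  removes at most half of it; integrating the rest yields the factor
  \<open>\<kappa> / p\<close>.\<close>

lemma J_lower_bound:
  assumes small: "small_scale \<kappa> e" and u: "norm (\<iota> u) \<le> e"
  shows "J 0 + \<kappa> / p * norm (\<iota> u) powr p \<le> J u"
proof (cases "u = 0")
  case True
  then show ?thesis by (simp add: \<iota>.zero)
next
  case False
  define n where "n = norm (\<iota> u)"
  have n: "0 < n" "n \<le> e" using False u by (auto simp: n_def)
  define h where "h t = J (t *\<^sub>R u) - \<kappa> / p * n powr p * t powr p" for t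
  have "h 0 \<le> h 1"
  proof (rule DERIV_nonneg_imp_increasing_open[of 0 1 h])
    fix t :: real assume t: "0 < t" "t < 1"
    define D where "D = blinfun_apply (J' (t *\<^sub>R u)) u - \<kappa> * n powr p * t powr (p - 1)"
    have "(h has_real_derivative D) (at t)"
      unfolding h_def D_def using t p J_line_derivative[of u 0 t]
      by (auto intro!: derivative_eq_intros)
    moreover have "0 \<le> D"
    proof -
      have tp: "t powr p = t * t powr (p - 1)" using t by (simp add: powr_mult_base)
      have np: "n powr p = n * n powr (p - 1)" using n by (simp add: powr_mult_base)
      have "2 * \<kappa> * n powr p * t powr p \<le> c1 * norm u powr p * t powr p"
        using small by (intro mult_right_mono) (auto simp: small_scale_def n_def)
      also have "\<dots> = c1 * norm (t *\<^sub>R u) powr p" using t by (simp add: powr_mult)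
      also have "\<dots> \<le> t * blinfun_apply (T (t *\<^sub>R u)) u"
        using T_coercive[of "t *\<^sub>R u"] by (simp add: blinfun.scaleR_right)
      finally have 1: "2 * \<kappa> * n powr p * t powr (p - 1) \<le> blinfun_apply (T (t *\<^sub>R u)) u"
        using t by (simp add: tp)
      have "norm (\<iota> (t *\<^sub>R u)) = t * n" using t by (simp add: \<iota>.scaleR n_def)
      then have "blinfun_apply (f (\<iota> (t *\<^sub>R u))) (\<iota> u) \<le> g (t * n) * n"
        using f_bound[of "t *\<^sub>R u" u] by (simp add: n_def)
      also have "\<dots> \<le> \<kappa> * (t * n) powr (p - 1) * n"
      proof (rule mult_right_mono)
        have "t * n \<le> 1 * e" using t n by (intro mult_mono) auto
        then show "g (t * n) \<le> \<kappa> * (t * n) powr (p - 1)"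
          using small t n by (simp add: small_scale_def)
      qed (use n in simp)
      also have "\<dots> = \<kappa> * n powr p * t powr (p - 1)"
        using t n by (simp add: powr_mult np)
      finally show ?thesis using 1 unfolding D_def by (simp add: J'_eq)
    qed
    ultimately show "\<exists>y. (h has_real_derivative y) (at t) \<and> 0 \<le> y" by blast
  next
    have "continuous_on {0..1} (\<lambda>t::real. t powr p)"
      by (rule continuous_on_powr') (use p in auto)
    moreover have "continuous_on {0..1} (\<lambda>t. J (t *\<^sub>R u))" by (intro continuous_intros)
    ultimately show "continuous_on {0..1} h"
      unfolding h_def by (intro continuous_on_diff continuous_on_mult continuous_on_const)
  qed simp
  then show ?thesis by (simp add: h_def n_def)
qed

subsection \<open>Additivity of the functional on the two parts\<close>

lemma parts_of_combination:
  assumes "0 \<le> s" "0 \<le> t"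
  shows "plus_part \<iota> (s *\<^sub>R plus_part \<iota> u + t *\<^sub>R minus_part \<iota> u) = s *\<^sub>R plus_part \<iota> u"
    and "minus_part \<iota> (s *\<^sub>R plus_part \<iota> u + t *\<^sub>R minus_part \<iota> u) = t *\<^sub>R minus_part \<iota> u"
proof -
  let ?a = "s *\<^sub>R pprt (\<iota> u)" and ?b = "t *\<^sub>R pprt (- \<iota> u)"
  have eq: "\<iota> (s *\<^sub>R plus_part \<iota> u + t *\<^sub>R minus_part \<iota> u) = ?a - ?b"
    by (simp add: \<iota>.add \<iota>.scaleR \<iota>_plus_part \<iota>_minus_part)
  have ab: "inf ?a ?b = 0" by (intro inf_scaleR_eq_0 inf_pprt_pprt_minus assms)
  show "plus_part \<iota> (s *\<^sub>R plus_part \<iota> u + t *\<^sub>R minus_part \<iota> u) = s *\<^sub>R plus_part \<iota> u"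
    using pprt_diff_disjoint[OF ab] by (intro plus_part_eqI) (simp add: eq \<iota>.scaleR \<iota>_plus_part)
  show "minus_part \<iota> (s *\<^sub>R plus_part \<iota> u + t *\<^sub>R minus_part \<iota> u) = t *\<^sub>R minus_part \<iota> u"
    using pprt_diff_disjoint[of ?b ?a] ab
    by (intro minus_part_eqI) (simp add: eq \<iota>.scaleR \<iota>_minus_part inf_commute)
qed

text \<open>\<open>g\<close> is of smaller order than \<open>s powr (p - 1)\<close>, which for
  \<open>s \<le> 1\<close> is at most \<open>s\<close> because \<open>p \<ge> 2\<close>.\<close>

lemma f_superlinear_at_0:
  assumes "0 < \<eta>"
  obtains s where "0 < s" "blinfun_apply (f (\<iota> (s *\<^sub>R a))) (\<iota> w) \<le> \<eta> * s"
proof (cases "a = 0")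
  case True
  then show ?thesis using that[of 1] assms by (simp add: \<iota>.zero)
next
  case False
  define n where "n = norm (\<iota> a)"
  \<comment> \<open>The added 1 keeps the divisor in \<eta>' positive when
    \<open>w = 0\<close>.\<close>
  define m where "m = norm (\<iota> w) + 1"
  have n: "0 < n" using False by (simp add: n_def)
  have m: "0 < m" "norm (\<iota> w) \<le> m" by (auto simp: m_def add_nonneg_pos)
  define \<eta>' where "\<eta>' = \<eta> / (n powr (p - 1) * m)"
  have \<eta>': "0 < \<eta>'" using assms n m by (simp add: \<eta>'_def)
  obtain e where e: "0 < e" "\<And>s. 0 < s \<Longrightarrow> s \<le> e \<Longrightarrow> g s \<le> \<eta>' * s powr (p - 1)"
    using g_small[OF \<eta>'] by blast
  define s where "s = min 1 (e / n)"
  have s: "0 < s" "s \<le> 1" using e n by (auto simp: s_def)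
  have "s \<le> e / n" by (simp add: s_def)
  then have sn: "s * n \<le> e" using n by (simp add: pos_le_divide_eq)
  have "blinfun_apply (f (\<iota> (s *\<^sub>R a))) (\<iota> w) \<le> g (s * n) * norm (\<iota> w)"
    using f_bound[of "s *\<^sub>R a" w] s by (simp add: \<iota>.scaleR n_def)
  also have "\<dots> \<le> \<eta>' * (s * n) powr (p - 1) * norm (\<iota> w)"
    using e(2)[of "s * n"] s n sn by (intro mult_right_mono) auto
  also have "\<dots> \<le> \<eta>' * (s * n) powr (p - 1) * m"
    using \<eta>' m by (intro mult_left_mono) auto
  also have "\<dots> = \<eta> * s powr (p - 1)"
    using s n m by (simp add: powr_mult \<eta>'_def)
  also have "\<dots> \<le> \<eta> * s powr 1"
    using s p assms by (intro mult_left_mono powr_mono') auto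
  finally show ?thesis using that[of s] s by simp
qed

text \<open>The offset \<open>k\<close> does not depend on \<open>s\<close>, so integration from 0
  produces the mixed term \<open>s * k\<close>; continuity covers the endpoint.\<close>

lemma J_add_of_affine_derivative:
  assumes "\<And>s. 0 < s \<Longrightarrow> blinfun_apply (J' (s *\<^sub>R a + w)) a = blinfun_apply (J' (s *\<^sub>R a)) a - k"
    and "0 \<le> s"
  shows "J (s *\<^sub>R a + w) = J (s *\<^sub>R a) + J w - J 0 - s * k"
proof (cases "s = 0")
  case False
  then have s: "0 < s" using assms by simp
  define h where "h s = J (s *\<^sub>R a + w) - J (s *\<^sub>R a) + s * k" for s
  have "h s = h 0"
  proof (rule DERIV_isconst_end[OF s])
    show "continuous_on {0..s} h" unfolding h_def by (intro continuous_intros)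
    fix x assume "0 < x" "x < s"
    then show "(h has_real_derivative 0) (at x)"
      unfolding h_def using assms(1)[of x] J_line_derivative[of a w x] J_line_derivative[of a 0 x]
      by (auto intro!: derivative_eq_intros)
  qed
  then show ?thesis by (simp add: h_def)
qed simp

text \<open>Integrating in either variable gives mixed terms with \<open>s * k t = t * l s\<close>, so \<open>l\<close> is linear;
  since \<open>l s = o(s)\<close> by \<open>g_lim\<close>, both vanish.\<close>

lemma J_disjoint_add:
  assumes st: "0 \<le> s" "0 \<le> t"
  shows "J (s *\<^sub>R plus_part \<iota> u + t *\<^sub>R minus_part \<iota> u)
       = J (s *\<^sub>R plus_part \<iota> u) + J (t *\<^sub>R minus_part \<iota> u) - J 0"
proof -
  let ?a = "plus_part \<iota> u" and ?b = "minus_part \<iota> u"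
  define k where "k t = blinfun_apply (f (\<iota> (t *\<^sub>R ?b))) (\<iota> ?a)" for t
  define l where "l s = blinfun_apply (f (\<iota> (s *\<^sub>R ?a))) (\<iota> ?b)" for s
  have f_eq: "f (\<iota> (s *\<^sub>R ?a + t *\<^sub>R ?b)) = f (\<iota> (s *\<^sub>R ?a)) + f (\<iota> (t *\<^sub>R ?b))" if "0 \<le> s" "0 \<le> t" for s t
    using f_split[of "s *\<^sub>R ?a + t *\<^sub>R ?b"] parts_of_combination[OF that] by simp
  \<comment> \<open>\<open>T_plus\<close> tests with \<open>s *\<^sub>R ?a\<close>; cancelling the
    factor \<open>s\<close> requires it to be positive.\<close>
  have T_a: "blinfun_apply (T (s *\<^sub>R ?a + t *\<^sub>R ?b)) ?a = blinfun_apply (T (s *\<^sub>R ?a)) ?a" if "0 < s" "0 \<le> t" for s t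
    using T_plus[of "s *\<^sub>R ?a + t *\<^sub>R ?b"] parts_of_combination[of s t u] that
    by (simp add: blinfun.scaleR_right)
  have T_b: "blinfun_apply (T (s *\<^sub>R ?a + t *\<^sub>R ?b)) ?b = blinfun_apply (T (t *\<^sub>R ?b)) ?b" if "0 \<le> s" "0 < t" for s t
    using T_minus[of "s *\<^sub>R ?a + t *\<^sub>R ?b"] parts_of_combination[of s t u] that
    by (simp add: blinfun.scaleR_right)
  have 1: "J (s *\<^sub>R ?a + t *\<^sub>R ?b) = J (s *\<^sub>R ?a) + J (t *\<^sub>R ?b) - J 0 - s * k t" if "0 \<le> s" "0 \<le> t" for s t
    by (rule J_add_of_affine_derivative[OF _ that(1)])
      (use that in \<open>simp add: J'_eq T_a f_eq k_def blinfun.add_left\<close>)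
  have 2: "J (t *\<^sub>R ?b + s *\<^sub>R ?a) = J (t *\<^sub>R ?b) + J (s *\<^sub>R ?a) - J 0 - t * l s" if "0 \<le> s" "0 \<le> t" for s t
    by (rule J_add_of_affine_derivative[OF _ that(2)])
      (use that in \<open>simp add: J'_eq T_b f_eq l_def blinfun.add_left add.commute[of _ "s *\<^sub>R ?a"]\<close>)
  have kl: "s * k t = t * l s" if "0 \<le> s" "0 \<le> t" for s t
    using 1[OF that] 2[OF that] by (simp add: add.commute)
  have l_lin: "l s = s * l 1" if "0 \<le> s" for s
    using kl[of 1 1] kl[of s 1] that by simp
  have l_le: "l 1 \<le> \<eta>" if \<eta>: "0 < \<eta>" for \<eta>
  proof -
    obtain s where s: "0 < s" "l s \<le> \<eta> * s"
      using f_superlinear_at_0[OF \<eta>, of ?a ?b] unfolding l_def by blast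
    then show ?thesis using l_lin[of s] by (simp add: mult.commute)
  qed
  have l_ge: "- l 1 \<le> \<eta>" if \<eta>: "0 < \<eta>" for \<eta>
  proof -
    obtain s where s: "0 < s" "- l s \<le> \<eta> * s"
      using f_superlinear_at_0[OF \<eta>, of ?a "- ?b"]
      unfolding l_def by (auto simp: \<iota>.neg blinfun.minus_right)
    then have "s * (- l 1) \<le> s * \<eta>" using l_lin[of s] by (simp add: mult.commute)
    then show ?thesis using s(1) by (simp only: mult_le_cancel_left_pos)
  qed
  have "l 1 \<le> 0" by (rule field_le_epsilon) (simp add: l_le)
  moreover have "- l 1 \<le> 0" by (rule field_le_epsilon) (use l_ge in simp)
  ultimately have "l s = 0" using l_lin[OF st(1)] by (metis antisym mult_zero_right neg_le_0_iff_le)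
  then show ?thesis using 2[OF st] by (simp add: add.commute)
qed

subsection \<open>Critical points in cones\<close>

lemma J_ray_le:
  assumes "u \<noteq> 0"
  obtains R where "0 < R" "\<And>t. R \<le> t \<Longrightarrow> J (t *\<^sub>R u) \<le> z"
proof -
  have "\<forall>\<^sub>F t in at_top. J (t *\<^sub>R u) \<le> z"
    using J_lim[OF assms] by (simp add: filterlim_at_bot)
  then obtain R where R: "\<And>t. R \<le> t \<Longrightarrow> J (t *\<^sub>R u) \<le> z"
    by (auto simp: eventually_at_top_linorder)
  show ?thesis by (rule that[of "max R 1"]) (use R in auto)
qed

lemma J_ray_bounded:
  obtains C where "\<And>t. 0 \<le> t \<Longrightarrow> J (t *\<^sub>R u) \<le> C"
proof (cases "u = 0")
  case False
  obtain R where R: "0 < R" "\<And>t. R \<le> t \<Longrightarrow> J (t *\<^sub>R u) \<le> 0" using J_ray_le[OF False] by blast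
  have "compact ((\<lambda>t. J (t *\<^sub>R u)) ` {0..R})"
    by (intro compact_continuous_image continuous_intros) auto
  then have "bdd_above ((\<lambda>t. J (t *\<^sub>R u)) ` {0..R})"
    by (intro bounded_imp_bdd_above compact_imp_bounded)
  then have "\<exists>C. \<forall>t\<in>{0..R}. J (t *\<^sub>R u) \<le> C"
    by (simp add: bdd_above_def)
  then obtain C where C: "\<forall>t\<in>{0..R}. J (t *\<^sub>R u) \<le> C" ..
  show ?thesis
  proof (rule that[of "max C 0"])
    fix t :: real assume "0 \<le> t"
    then show "J (t *\<^sub>R u) \<le> max C 0" using C R(2)[of t] by (cases "t \<le> R") (auto simp: le_max_iff_disj)
  qed
next
  case True
  then show ?thesis using that[of "J 0"] by simp
qed

text \<open>A mountain pass confined to \<open>S\<close>, which is later taken to be either cone. No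
  point is excluded from the supremum, so \<open>U\<close> is the whole space.\<close>

lemma critical_point_in_cone:
  assumes S: "closed S"
    and cone: "\<And>x t. x \<in> S \<Longrightarrow> 0 \<le> t \<Longrightarrow> t *\<^sub>R x \<in> S"
    and A_inv: "\<And>x t. x \<in> S \<Longrightarrow> 0 \<le> t \<Longrightarrow> t \<le> 1 \<Longrightarrow> x + t *\<^sub>R (A x - x) \<in> S"
    and w: "w \<in> S" "w \<noteq> 0"
  obtains l where "l \<in> S" "l \<noteq> 0" "J' l = 0"
proof -
  obtain \<kappa> e where small: "small_scale \<kappa> e" using small_scale_exists by blast
  then have \<kappa>: "0 < \<kappa>" "0 < e" by (auto simp: small_scale_def)
  obtain R where R: "0 < R" "J (R *\<^sub>R w) \<le> J 0 - 1" using J_ray_le[OF w(2)] by blast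
  \<comment> \<open>The lower bound of \<open>J\<close> on the set
    \<open>norm (\<iota> u) = e\<close>, which each path crosses because
    \<open>J (R *\<^sub>R w) < J 0\<close> forces its end outside.\<close>
  define \<alpha> where "\<alpha> = J 0 + \<kappa> / p * e powr p"
  have \<alpha>: "J 0 < \<alpha>" using \<kappa> p by (simp add: \<alpha>_def)
  define \<Gamma> :: "(real \<Rightarrow>\<^sub>C 'x) set" where
    "\<Gamma> = {\<phi>. (\<forall>t. apply_bcontfun \<phi> t = \<phi> (clamp01 t)) \<and> \<phi> 0 = 0 \<and> \<phi> 1 = R *\<^sub>R w \<and> (\<forall>t. \<phi> t \<in> S)}"
  have "(\<lambda>t. (clamp01 t * R) *\<^sub>R w) \<in> bcontfun"
    by (rule bcontfun_comp_compact[of clamp01 "{0..1}" "\<lambda>t. (t * R) *\<^sub>R w"])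
      (auto intro!: continuous_intros continuous_on_clamp01[OF continuous_on_id, unfolded id_def])
  then obtain \<phi>0 :: "real \<Rightarrow>\<^sub>C 'x" where \<phi>0: "\<And>t. \<phi>0 t = (clamp01 t * R) *\<^sub>R w"
    by (metis bcontfunE)
  obtain l where l: "J' l = 0" "\<alpha> \<le> J l" "l \<in> closure {apply_bcontfun \<phi> q |\<phi> q. \<phi> \<in> \<Gamma> \<and> \<phi> q \<in> UNIV}"
  proof (rule minimax_critical_point[of \<Gamma> \<phi>0 "J 0" UNIV \<alpha>])
    show "closed \<Gamma>"
      unfolding \<Gamma>_def
      by (intro closed_Collect_conj closed_Collect_all closed_Collect_eq continuous_on_bcontfun_eval
          closed_bcontfun_eval_mem S continuous_on_const)
    show "\<phi>0 \<in> \<Gamma>"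
      using cone[OF w(1)] R by (auto simp: \<Gamma>_def \<phi>0)
    show "compact (range \<phi>)" if "\<phi> \<in> \<Gamma>" for \<phi>
      by (rule compact_range_bcontfun_retract[of \<phi> clamp01 "{0..1}"]) (use that in \<open>auto simp: \<Gamma>_def\<close>)
    show "\<psi> \<in> \<Gamma>" if "\<phi> \<in> \<Gamma>" and \<tau>: "\<And>u. 0 \<le> \<tau> u \<and> \<tau> u \<le> 1" "\<And>u. J u \<le> J 0 \<Longrightarrow> \<tau> u = 0"
      and \<psi>: "\<And>q. apply_bcontfun \<psi> q = \<phi> q + \<tau> (\<phi> q) *\<^sub>R (A (\<phi> q) - \<phi> q)" for \<phi> \<psi> \<tau>
    proof -
      have \<phi>: "\<phi> t = \<phi> (clamp01 t)" "\<phi> 0 = 0" "\<phi> 1 = R *\<^sub>R w" "\<phi> t \<in> S" for t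
        using that(1) unfolding \<Gamma>_def by blast+
      have "\<psi> t = \<psi> (clamp01 t)" for t unfolding \<psi> using \<phi>(1)[of t] by simp
      \<comment> \<open>The endpoints survive for different reasons: 0 is a fixed point of
        \<open>A\<close>, and at \<open>R *\<^sub>R w\<close> the level is so low that \<tau>
        vanishes.\<close>
      moreover have "\<psi> 0 = 0" by (simp add: \<psi> \<phi>(2) A_0)
      moreover have "\<psi> 1 = R *\<^sub>R w" using R \<tau>(2)[of "R *\<^sub>R w"] by (simp add: \<psi> \<phi>(3))
      moreover have "\<psi> t \<in> S" for t unfolding \<psi> using \<tau>(1) by (intro A_inv \<phi>(4)) auto
      ultimately show ?thesis by (simp add: \<Gamma>_def)
    qed
    show "\<exists>q. \<phi> q \<in> UNIV \<and> \<alpha> \<le> J (\<phi> q)" if "\<phi> \<in> \<Gamma>" for \<phi>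
    proof -
      have "\<not> norm (\<iota> (R *\<^sub>R w)) \<le> e"
      proof
        assume "norm (\<iota> (R *\<^sub>R w)) \<le> e"
        from J_lower_bound[OF small this] have "J 0 \<le> J (R *\<^sub>R w)"
          using \<kappa> p by (smt (verit) divide_pos_pos mult_nonneg_nonneg powr_ge_zero)
        then show False using R by linarith
      qed
      then have "norm (\<iota> (\<phi> 0)) \<le> e" "e \<le> norm (\<iota> (\<phi> 1))"
        using that \<kappa> by (auto simp: \<Gamma>_def \<iota>.zero)
      then obtain t where "norm (\<iota> (\<phi> t)) = e"
        using IVT'[of "\<lambda>t. norm (\<iota> (\<phi> t))" 0 e 1] by (force intro: continuous_intros)
      then have "\<alpha> \<le> J (\<phi> t)" using J_lower_bound[OF small, of "\<phi> t"] by (simp add: \<alpha>_def)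
      then show ?thesis by blast
    qed
  qed (use \<alpha> in auto)
  have "{apply_bcontfun \<phi> q |\<phi> q. \<phi> \<in> \<Gamma> \<and> \<phi> q \<in> UNIV} \<subseteq> S" by (auto simp: \<Gamma>_def)
  then have "l \<in> S" using l(3) S closure_minimal by blast
  moreover have "l \<noteq> 0" using l(2) \<alpha> by auto
  ultimately show ?thesis using that l by blast
qed

subsection \<open>Sign-changing critical points\<close>

lemma closed_cone: "closed {u. 0 \<le> \<iota> u}" "closed {u. \<iota> u \<le> 0}"
proof -
  have "{u. 0 \<le> \<iota> u} = {u. pnorm (- \<iota> u) = 0}" "{u. \<iota> u \<le> 0} = {u. pnorm (\<iota> u) = 0}"
    by (auto simp: pnorm_eq_0_iff)
  moreover have "closed {u. pnorm (- \<iota> u) = 0}" "closed {u. pnorm (\<iota> u) = 0}"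
    by (auto intro!: closed_Collect_eq continuous_intros)
  ultimately show "closed {u. 0 \<le> \<iota> u}" "closed {u. \<iota> u \<le> 0}" by simp_all
qed

lemma A_segment_cone:
  assumes "0 \<le> t" "t \<le> 1"
  shows "0 \<le> \<iota> u \<Longrightarrow> 0 \<le> \<iota> (u + t *\<^sub>R (A u - u))"
    and "\<iota> u \<le> 0 \<Longrightarrow> \<iota> (u + t *\<^sub>R (A u - u)) \<le> 0"
proof -
  obtain \<kappa> e where small: "small_scale \<kappa> e" using small_scale_exists by blast
  then have e: "0 \<le> e" by (simp add: small_scale_def)
  show "0 \<le> \<iota> (u + t *\<^sub>R (A u - u))" if "0 \<le> \<iota> u"
  proof -
    have "pnorm (- \<iota> u) = 0" using that by (simp add: pnorm_eq_0_iff)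
    then have "pnorm (- \<iota> (u + t *\<^sub>R (A u - u))) \<le> 0"
      using e assms by (intro pnorm_minus_A_segment_le[OF small]) auto
    then have "pnorm (- \<iota> (u + t *\<^sub>R (A u - u))) = 0" by (simp add: antisym)
    then show ?thesis by (simp add: pnorm_eq_0_iff)
  qed
  show "\<iota> (u + t *\<^sub>R (A u - u)) \<le> 0" if "\<iota> u \<le> 0"
  proof -
    have "pnorm (\<iota> u) = 0" using that by (simp add: pnorm_eq_0_iff)
    then have "pnorm (\<iota> (u + t *\<^sub>R (A u - u))) \<le> 0"
      using e assms by (intro pnorm_A_segment_le[OF small]) auto
    then have "pnorm (\<iota> (u + t *\<^sub>R (A u - u))) = 0" by (simp add: antisym)
    then show ?thesis by (simp add: pnorm_eq_0_iff)
  qed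
qed

text \<open>The Archimedean property of a Banach lattice: \<open>n * pnorm (\<iota> e)\<close> stays
  below \<open>pnorm (\<iota> u)\<close> for all \<open>n\<close>.\<close>

lemma nonpos_if_multiples_bounded_above:
  assumes "\<And>n::nat. \<iota> (real n *\<^sub>R e) \<le> \<iota> u"
  shows "\<iota> e \<le> 0"
proof -
  have le: "pnorm (\<iota> e) \<le> pnorm (\<iota> u) / real (Suc n)" for n
  proof -
    have "pprt (\<iota> (real (Suc n) *\<^sub>R e)) \<le> pprt (\<iota> u)" using assms by (rule pprt_mono)
    then have "pnorm (\<iota> (real (Suc n) *\<^sub>R e)) \<le> pnorm (\<iota> u)"
      unfolding pnorm_def by (intro norm_mono_banach_lattice) auto
    moreover have "pnorm (\<iota> (real (Suc n) *\<^sub>R e)) = real (Suc n) * pnorm (\<iota> e)"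
      unfolding \<iota>.scaleR by (rule pnorm_scaleR) simp
    ultimately show ?thesis by (simp only: pos_le_divide_eq of_nat_0_less_iff zero_less_Suc mult.commute)
  qed
  have "(\<lambda>n. pnorm (\<iota> u) * inverse (real (Suc n))) \<longlonglongrightarrow> pnorm (\<iota> u) * 0"
    by (intro tendsto_intros LIMSEQ_inverse_real_of_nat)
  then have "pnorm (\<iota> e) \<le> 0"
    using le by (intro LIMSEQ_le_const[of "\<lambda>n. pnorm (\<iota> u) * inverse (real (Suc n))"])
      (auto simp: divide_inverse)
  then have "pnorm (\<iota> e) = 0" by (simp add: antisym)
  then show ?thesis by (simp add: pnorm_eq_0_iff)
qed

text \<open>If all elements of \<open>X\<close> were comparable with 0, take \<open>e > 0\<close>.
  The reals \<open>r\<close> with \<open>r *\<^sub>R e\<close> below \<open>u\<close>, and those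
  with it above, form two closed sets covering the line, nonempty by the Archimedean property. By
  connectedness they meet, so \<open>u\<close> is a multiple of \<open>e\<close> and
  \<open>X\<close> is a line.\<close>

lemma sign_changing_element:
  assumes dimX: "\<nexists>x. span {x} = (UNIV :: 'x set)"
  obtains u where "\<not> 0 \<le> \<iota> u" "\<not> \<iota> u \<le> 0"
proof (rule ccontr)
  assume "\<not> thesis"
  then have total: "0 \<le> \<iota> u \<or> \<iota> u \<le> 0" for u using that by blast
  have "\<exists>u::'x. u \<noteq> 0"
  proof (rule ccontr)
    assume "\<nexists>u::'x. u \<noteq> 0"
    then have "span {0} = (UNIV :: 'x set)" by auto
    then show False using dimX by blast
  qed
  then obtain e' :: 'x where "e' \<noteq> 0" by blast
  then obtain e :: 'x where e: "e \<noteq> 0" "0 \<le> \<iota> e"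
    using total[of e'] that by (metis \<iota>.neg neg_0_equal_iff_equal neg_0_le_iff_le)
  have "u \<in> span {e}" for u
  proof -
    let ?P = "{r. 0 \<le> \<iota> (u - r *\<^sub>R e)}" and ?N = "{r. \<iota> (u - r *\<^sub>R e) \<le> 0}"
    have "closed ?P" "closed ?N"
      using continuous_closed_vimage[OF closed_cone(1), of "\<lambda>r. u - r *\<^sub>R e"]
        continuous_closed_vimage[OF closed_cone(2), of "\<lambda>r. u - r *\<^sub>R e"]
      by (auto simp: vimage_def intro!: continuous_intros)
    moreover have "?P \<union> ?N = UNIV" using total by blast
    moreover have "?P \<noteq> {}"
    proof
      assume "?P = {}"
      then have "\<iota> (u - (- real n) *\<^sub>R e) \<le> 0" for n using total by blast
      then have "\<iota> (real n *\<^sub>R e) \<le> \<iota> (- u)" for n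
        by (simp add: \<iota>.diff \<iota>.add \<iota>.neg \<iota>.scaleR le_eq_neg add.commute)
      then have "\<iota> e \<le> 0" by (rule nonpos_if_multiples_bounded_above)
      then show False using e by (metis antisym \<iota>_eq_0_iff)
    qed
    moreover have "?N \<noteq> {}"
    proof
      assume "?N = {}"
      then have "0 \<le> \<iota> (u - real n *\<^sub>R e)" for n using total by blast
      then have "\<iota> (real n *\<^sub>R e) \<le> \<iota> u" for n by (simp add: \<iota>.diff)
      then have "\<iota> e \<le> 0" by (rule nonpos_if_multiples_bounded_above)
      then show False using e by (metis antisym \<iota>_eq_0_iff)
    qed
    ultimately have "?P \<inter> ?N \<noteq> {}"
      using connected_UNIV[where 'a = real] unfolding connected_closed by (metis Int_UNIV_right Int_commute order_refl)
    then obtain r where "r \<in> ?P" "r \<in> ?N" by blast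
    then have "\<iota> (u - r *\<^sub>R e) = 0" unfolding mem_Collect_eq by (intro antisym)
    then have "u = r *\<^sub>R e" by simp
    then show ?thesis by (simp add: span_base span_scale)
  qed
  then show False using dimX by blast
qed

text \<open>The path runs over two sides of a rectangle spanned by the two parts of \<open>u\<close>; on them
  additivity of \<open>J\<close> on the parts makes \<open>J\<close> uniformly negative, which \<open>J_lim\<close> alone would not give.\<close>

lemma negative_path:
  assumes u: "\<not> 0 \<le> \<iota> u" "\<not> \<iota> u \<le> 0"
  obtains \<gamma> where "continuous_on UNIV \<gamma>" "0 \<le> \<iota> (\<gamma> 0)" "\<iota> (\<gamma> 1) \<le> 0"
    "\<And>t::real. 0 \<le> t \<Longrightarrow> t \<le> 1 \<Longrightarrow> J (\<gamma> t) < J 0"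
proof -
  let ?a = "plus_part \<iota> u" and ?b = "minus_part \<iota> u"
  have "pprt (\<iota> u) \<noteq> 0" "pprt (- \<iota> u) \<noteq> 0"
    using u by (auto simp flip: le_zero_iff_zero_pprt)
  then have ab: "?a \<noteq> 0" "?b \<noteq> 0"
    using \<iota>_plus_part[of u] \<iota>_minus_part[of u] by (auto simp: \<iota>.zero)
  obtain Ca where Ca: "\<And>t. 0 \<le> t \<Longrightarrow> J (t *\<^sub>R ?a) \<le> Ca" using J_ray_bounded by blast
  obtain Cb where Cb: "\<And>t. 0 \<le> t \<Longrightarrow> J (t *\<^sub>R ?b) \<le> Cb" using J_ray_bounded by blast
  define z where "z = 2 * J 0 - max Ca Cb - 1"
  obtain Ra where Ra: "0 < Ra" "\<And>t. Ra \<le> t \<Longrightarrow> J (t *\<^sub>R ?a) \<le> z" using J_ray_le[OF ab(1)] by blast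
  obtain Rb where Rb: "0 < Rb" "\<And>t. Rb \<le> t \<Longrightarrow> J (t *\<^sub>R ?b) \<le> z" using J_ray_le[OF ab(2)] by blast
  define R where "R = max Ra Rb"
  define s1 s2 where "s1 t = clamp01 (2 - 2 * t) * R" and "s2 t = clamp01 (2 * t) * R" for t :: real
  define \<gamma> where "\<gamma> t = s1 t *\<^sub>R ?a + s2 t *\<^sub>R ?b" for t
  have R: "0 < R" "Ra \<le> R" "Rb \<le> R" using Ra by (auto simp: R_def)
  have s: "0 \<le> s1 t" "0 \<le> s2 t" for t using R by (auto simp: s1_def s2_def)
  show ?thesis
  proof
    show "continuous_on UNIV \<gamma>" unfolding \<gamma>_def s1_def s2_def by (intro continuous_intros)
    have "clamp01 2 = 1" by (simp add: clamp01_def)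
    then show "0 \<le> \<iota> (\<gamma> 0)" "\<iota> (\<gamma> 1) \<le> 0"
      using R by (simp_all add: \<gamma>_def s1_def s2_def \<iota>.scaleR \<iota>_plus_part \<iota>_minus_part scaleR_nonneg_nonneg)
    fix t :: real assume "0 \<le> t" "t \<le> 1"
    then have "s1 t = R \<or> s2 t = R" by (cases "t \<le> 1/2") (auto simp: s1_def s2_def clamp01_def)
    then have "J (s1 t *\<^sub>R ?a) + J (s2 t *\<^sub>R ?b) \<le> z + max Ca Cb"
      using Ra(2)[of R] Rb(2)[of R] Ca[OF s(1)[of t]] Cb[OF s(2)[of t]] R by fastforce
    then show "J (\<gamma> t) < J 0" using J_disjoint_add[OF s(1)[of t] s(2)[of t], of u] by (simp add: \<gamma>_def z_def)
  qed
qed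

lemma sign_changing_critical_point:
  assumes dimX: "\<nexists>x. span {x} = (UNIV :: 'x set)"
  obtains l where "J' l = 0" "\<not> 0 \<le> \<iota> l" "\<not> \<iota> l \<le> 0"
proof -
  obtain \<gamma> where \<gamma>_cont: "continuous_on UNIV \<gamma>" and \<gamma>01: "0 \<le> \<iota> (\<gamma> 0)" "\<iota> (\<gamma> 1) \<le> 0"
    and \<gamma>_neg: "\<And>t::real. 0 \<le> t \<Longrightarrow> t \<le> 1 \<Longrightarrow> J (\<gamma> t) < J 0"
    using sign_changing_element[OF dimX] negative_path by metis
  obtain \<kappa> e where small: "small_scale \<kappa> e" using small_scale_exists by blast
  then have \<kappa>: "0 < \<kappa>" "0 < e" by (auto simp: small_scale_def)
  \<comment> \<open>At the linking point both parts have norm \<open>2 * \<epsilon>\<close>, so the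
    whole has norm at most \<open>4 * \<epsilon> = e\<close>, where \<open>J_lower_bound\<close>
    applies.\<close>
  define \<epsilon> where "\<epsilon> = e / 4"
  have \<epsilon>: "0 < \<epsilon>" "4 * \<epsilon> = e" "\<epsilon> \<le> e" using \<kappa> by (auto simp: \<epsilon>_def)
  define \<alpha> where "\<alpha> = J 0 + \<kappa> / p * (2 * \<epsilon>) powr p"
  have \<alpha>: "J 0 < \<alpha>" using \<kappa> p \<epsilon> by (simp add: \<alpha>_def)
  let ?N = "\<lambda>u. pnorm (\<iota> u)" and ?M = "\<lambda>u. pnorm (- \<iota> u)"
  define U where "U = {u. \<epsilon> < ?N u} \<inter> {u. \<epsilon> < ?M u}"
  \<comment> \<open>The side \<open>s = 0\<close> is collapsed to 0, the side \<open>s = 1\<close>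
    follows \<gamma>, and the sides \<open>t = 0\<close> and \<open>t = 1\<close> lie in the
    positive and the negative cone.\<close>
  define \<Gamma> :: "((real \<times> real) \<Rightarrow>\<^sub>C 'x) set" where
    "\<Gamma> = {\<phi>. (\<forall>z. apply_bcontfun \<phi> z = \<phi> (clamp_square z))
           \<and> (\<forall>t. \<phi> (0, t) = 0) \<and> (\<forall>t. \<phi> (1, t) = \<gamma> (clamp01 t))
           \<and> (\<forall>s. \<phi> (s, 0) \<in> {u. 0 \<le> \<iota> u}) \<and> (\<forall>s. \<phi> (s, 1) \<in> {u. \<iota> u \<le> 0})}"
  have "(\<lambda>z. (\<lambda>z. fst z *\<^sub>R \<gamma> (snd z)) (clamp_square z)) \<in> bcontfun"
  proof (rule bcontfun_comp_compact[of clamp_square "{0..1} \<times> {0..1}"])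
    show "continuous_on ({0..1} \<times> {0..1}) (\<lambda>z. fst z *\<^sub>R \<gamma> (snd z))"
      by (intro continuous_intros continuous_on_compose2[OF \<gamma>_cont]) auto
  qed (auto simp: range_clamp_square[unfolded image_subset_iff] continuous_on_clamp_square compact_Times)
  then obtain \<phi>0 :: "(real \<times> real) \<Rightarrow>\<^sub>C 'x"
    where "(\<lambda>z. fst (clamp_square z) *\<^sub>R \<gamma> (snd (clamp_square z))) = \<phi>0"
    by (rule bcontfunE)
  then have \<phi>0: "\<phi>0 z = fst (clamp_square z) *\<^sub>R \<gamma> (snd (clamp_square z))" for z
    by metis
  obtain l where l: "J' l = 0" "\<alpha> \<le> J l" "l \<in> closure {apply_bcontfun \<phi> q |\<phi> q. \<phi> \<in> \<Gamma> \<and> \<phi> q \<in> U}"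
  proof (rule minimax_critical_point[of \<Gamma> \<phi>0 "J 0" U \<alpha>])
    show "closed \<Gamma>"
      unfolding \<Gamma>_def
      by (intro closed_Collect_conj closed_Collect_all closed_Collect_eq continuous_on_bcontfun_eval
          closed_bcontfun_eval_mem closed_cone continuous_on_const)
    show "\<phi>0 \<in> \<Gamma>"
      using \<gamma>01 unfolding \<Gamma>_def mem_Collect_eq \<phi>0
      by (auto simp: \<iota>.scaleR scaleR_nonneg_nonneg scaleR_nonneg_nonpos)
    show "compact (range \<phi>)" if "\<phi> \<in> \<Gamma>" for \<phi>
      by (rule compact_range_bcontfun_retract[OF _ range_clamp_square])
        (use that in \<open>auto simp: \<Gamma>_def compact_Times\<close>)
    show "\<psi> \<in> \<Gamma>" if "\<phi> \<in> \<Gamma>" and \<tau>: "\<And>u. 0 \<le> \<tau> u \<and> \<tau> u \<le> 1" "\<And>u. J u \<le> J 0 \<Longrightarrow> \<tau> u = 0"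
      and \<psi>: "\<And>q. apply_bcontfun \<psi> q = \<phi> q + \<tau> (\<phi> q) *\<^sub>R (A (\<phi> q) - \<phi> q)" for \<phi> \<psi> \<tau>
    proof -
      have \<phi>: "\<phi> z = \<phi> (clamp_square z)" "\<phi> (0, t) = 0" "\<phi> (1, t) = \<gamma> (clamp01 t)"
        "0 \<le> \<iota> (\<phi> (s, 0))" "\<iota> (\<phi> (s, 1)) \<le> 0" for z s t
        using that(1) unfolding \<Gamma>_def by blast+
      have "\<psi> z = \<psi> (clamp_square z)" for z unfolding \<psi> using \<phi>(1)[of z] by simp
      moreover have "\<psi> (0, t) = 0" for t by (simp add: \<psi> \<phi>(2) A_0)
      \<comment> \<open>On this side the level is below \<open>J 0\<close>, where \<tau>
        vanishes.\<close>
      moreover have "\<psi> (1, t) = \<gamma> (clamp01 t)" for t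
        using \<tau>(2)[OF less_imp_le[OF \<gamma>_neg[of "clamp01 t"]]] by (simp add: \<psi> \<phi>(3))
      moreover have "0 \<le> \<iota> (\<psi> (s, 0))" for s
        unfolding \<psi> using \<tau>(1) \<phi>(4) by (intro A_segment_cone) auto
      moreover have "\<iota> (\<psi> (s, 1)) \<le> 0" for s
        unfolding \<psi> using \<tau>(1) \<phi>(5) by (intro A_segment_cone) auto
      ultimately show ?thesis unfolding \<Gamma>_def mem_Collect_eq by blast
    qed
    show "open U"
      unfolding U_def by (intro open_Int open_Collect_less continuous_intros)
    \<comment> \<open>Outside \<open>U\<close> one of the two distances is at most \<epsilon>, and
      that same sublevel set is preserved by the step.\<close>
    show "u + t *\<^sub>R (A u - u) \<notin> U" if "u \<notin> U" "0 \<le> t" "t \<le> 1" for u t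
      using that pnorm_A_segment_le[OF small _ \<epsilon>(3), of u t] pnorm_minus_A_segment_le[OF small _ \<epsilon>(3), of u t]
      by (auto simp: U_def not_less)
    show "\<exists>q. \<phi> q \<in> U \<and> \<alpha> \<le> J (\<phi> q)" if "\<phi> \<in> \<Gamma>" for \<phi>
    proof -
      have \<phi>: "\<phi> (0, t) = 0" "\<phi> (1, t) = \<gamma> (clamp01 t)"
        "0 \<le> \<iota> (\<phi> (s, 0))" "\<iota> (\<phi> (s, 1)) \<le> 0" for s t
        using that unfolding \<Gamma>_def by blast+
      \<comment> \<open>\<open>J (\<gamma> t) < J 0\<close> excludes norms up to
        \<open>e = 4 * \<epsilon>\<close>, so one of the two parts must reach
        \<open>2 * \<epsilon>\<close>.\<close>
      have far: "2 * \<epsilon> \<le> max (?N (\<gamma> t)) (?M (\<gamma> t))" if "0 \<le> t" "t \<le> 1" for t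
      proof (rule ccontr)
        assume "\<not> ?thesis"
        then have "norm (\<iota> (\<gamma> t)) \<le> e"
          using norm_le_pnorm_add[of "\<iota> (\<gamma> t)"] \<epsilon> by linarith
        from J_lower_bound[OF small this] have "J 0 \<le> J (\<gamma> t)"
          using \<kappa> p by (smt (verit) divide_pos_pos mult_nonneg_nonneg powr_ge_zero)
        then show False using \<gamma>_neg[OF that] by linarith
      qed
      \<comment> \<open>The first function changes sign between the collapsed side and \<gamma>, the
        second between the two cones; a common zero has both parts equal to
        \<open>2 * \<epsilon>\<close>.\<close>
      have "\<exists>z\<in>cbox (0, 0) (1, 1). max (?N (\<phi> z)) (?M (\<phi> z)) - 2 * \<epsilon> = 0 \<and> ?M (\<phi> z) - ?N (\<phi> z) = 0"
      proof (rule Poincare_Miranda_plane)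
        show "max (?N (\<phi> (0, t))) (?M (\<phi> (0, t))) - 2 * \<epsilon> \<le> 0
            \<and> 0 \<le> max (?N (\<phi> (1, t))) (?M (\<phi> (1, t))) - 2 * \<epsilon>" if "0 \<le> t" "t \<le> 1" for t
          using far[OF that] that \<epsilon> by (simp add: \<phi>(1,2) \<iota>.zero)
        show "?M (\<phi> (s, 0)) - ?N (\<phi> (s, 0)) \<le> 0 \<and> 0 \<le> ?M (\<phi> (s, 1)) - ?N (\<phi> (s, 1))" for s
          using \<phi>(3,4)[of s] by (simp add: pnorm_eq_0_iff[THEN iffD2])
      qed (intro continuous_intros continuous_on_apply_bcontfun)+
      then obtain z where z: "?N (\<phi> z) = 2 * \<epsilon>" "?M (\<phi> z) = 2 * \<epsilon>" by auto
      have "norm (\<iota> (\<phi> z)) \<le> e" using norm_le_pnorm_add[of "\<iota> (\<phi> z)"] z \<epsilon> by linarith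
      then have "J 0 + \<kappa> / p * norm (\<iota> (\<phi> z)) powr p \<le> J (\<phi> z)" by (rule J_lower_bound[OF small])
      moreover have "\<kappa> / p * (2 * \<epsilon>) powr p \<le> \<kappa> / p * norm (\<iota> (\<phi> z)) powr p"
        using pnorm_le_norm[of "\<iota> (\<phi> z)"] z \<epsilon> \<kappa> p by (intro mult_left_mono powr_mono2) auto
      ultimately have "\<alpha> \<le> J (\<phi> z)" by (simp add: \<alpha>_def)
      moreover have "\<phi> z \<in> U" using z \<epsilon> by (simp add: U_def)
      ultimately show ?thesis by blast
    qed
  qed (use \<alpha> in auto)
  \<comment> \<open>The strict inequalities defining \<open>U\<close> become weak in the closure,
    and the bound \<epsilon> > 0 still keeps both parts of \<open>l\<close> nonzero.\<close>
  have "{apply_bcontfun \<phi> q |\<phi> q. \<phi> \<in> \<Gamma> \<and> \<phi> q \<in> U} \<subseteq> {u. \<epsilon> \<le> ?N u} \<inter> {u. \<epsilon> \<le> ?M u}"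
    by (auto simp: U_def)
  moreover have "closed ({u. \<epsilon> \<le> ?N u} \<inter> {u. \<epsilon> \<le> ?M u})"
    by (intro closed_Int closed_Collect_le continuous_intros)
  ultimately have "l \<in> {u. \<epsilon> \<le> ?N u} \<inter> {u. \<epsilon> \<le> ?M u}"
    using l(3) closure_minimal by blast
  then have "?N l \<noteq> 0" "?M l \<noteq> 0" using \<epsilon> by auto
  then show ?thesis using that[OF l(1)] by (simp add: pnorm_eq_0_iff)
qed

section \<open>Assembly of the three solutions\<close>

lemma exists_solutions:
  assumes dimX: "\<nexists>x. span {x} = (UNIV :: 'x set)"
  shows "(\<exists>u. positive_solution \<iota> T f u) \<and>
         (\<exists>u. negative_solution \<iota> T f u) \<and>
         (\<exists>u. sign_changing_solution \<iota> T f u)"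
proof (intro conjI)
  \<comment> \<open>The two parts of a sign-changing element supply nonzero directions in the two
    cones for the mountain passes.\<close>
  obtain w where w: "\<not> 0 \<le> \<iota> w" "\<not> \<iota> w \<le> 0" using sign_changing_element[OF dimX] by blast
  have "pprt (\<iota> w) \<noteq> 0" "pprt (- \<iota> w) \<noteq> 0"
    using w by (auto simp flip: le_zero_iff_zero_pprt)
  then have ab: "plus_part \<iota> w \<noteq> 0" "minus_part \<iota> w \<noteq> 0"
    using \<iota>_plus_part[of w] \<iota>_minus_part[of w] by (auto simp: \<iota>.zero)
  obtain l where "l \<in> {u. 0 \<le> \<iota> u}" "l \<noteq> 0" "J' l = 0"
    by (rule critical_point_in_cone[OF closed_cone(1), of "plus_part \<iota> w"])
      (use ab in \<open>auto simp: \<iota>.scaleR \<iota>_plus_part scaleR_nonneg_nonneg A_segment_cone\<close>)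
  then show "\<exists>u. positive_solution \<iota> T f u"
    by (auto simp: positive_solution_def is_solution_iff cone_in_def pos_cone_def)
  obtain l where "l \<in> {u. \<iota> u \<le> 0}" "l \<noteq> 0" "J' l = 0"
    by (rule critical_point_in_cone[OF closed_cone(2), of "minus_part \<iota> w"])
      (use ab in \<open>auto simp: \<iota>.scaleR \<iota>_minus_part scaleR_nonneg_nonpos A_segment_cone\<close>)
  then show "\<exists>u. negative_solution \<iota> T f u"
    by (auto simp: negative_solution_def is_solution_iff cone_in_def pos_cone_def \<iota>.neg)
  obtain l where "J' l = 0" "\<not> 0 \<le> \<iota> l" "\<not> \<iota> l \<le> 0"
    using sign_changing_critical_point[OF dimX] by blast
  then show "\<exists>u. sign_changing_solution \<iota> T f u"
    by (auto simp: sign_changing_solution_def is_solution_iff cone_in_def pos_cone_def \<iota>.neg \<iota>.zero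
        intro!: exI[of _ l])
qed

end

theorem theorem2p1:
  fixes \<iota> :: "'x::banach \<Rightarrow> 'e::banach_lattice"
    and J :: "'x \<Rightarrow> real"
    and J' :: "'x \<Rightarrow> 'x \<Rightarrow>\<^sub>L real"
    and T :: "'x \<Rightarrow> 'x \<Rightarrow>\<^sub>L real"
    and f :: "'e \<Rightarrow> 'e \<Rightarrow>\<^sub>L real"
    and p c1 :: real
    and g :: "real \<Rightarrow> real"
  assumes reflX: "reflexive_space TYPE('x)"
    and reflE: "reflexive_space TYPE('e)"
    and emb: "compact_embedding \<iota>"
    and parts: "\<And>u. pprt (\<iota> u) \<in> range \<iota> \<and> - pprt (- \<iota> u) \<in> range \<iota>"
    \<comment> \<open>implicit in the source: \<open>X\<close> has dimension at least two and \<open>0\<close> is a solution\<close>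
    and dimX: "\<nexists>x. span {x} = (UNIV :: 'x set)"
    and T0: "T 0 = 0"
    \<comment> \<open>H1\<close>
    and J_deriv: "\<And>u. (J has_derivative blinfun_apply (J' u)) (at u)"
    and J'_cont: "continuous_on UNIV J'"
    and J'_eq: "\<And>u v. blinfun_apply (J' u) v =
                  blinfun_apply (T u) v - blinfun_apply (f (\<iota> u)) (\<iota> v)"
    and f_cont: "continuous_on UNIV f"
    and T_cont: "continuous_on UNIV T"
    and T_plus: "\<And>u. blinfun_apply (T u) (plus_part \<iota> u) =
                  blinfun_apply (T (plus_part \<iota> u)) (plus_part \<iota> u)"
    and T_minus: "\<And>u. blinfun_apply (T u) (minus_part \<iota> u) =
                  blinfun_apply (T (minus_part \<iota> u)) (minus_part \<iota> u)"
    and c1: "c1 > 0"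
    and p: "p \<ge> 2"
    and T_mono: "\<And>u v. blinfun_apply (T u - T v) (u - v) \<ge> c1 * norm (u - v) powr p"
    \<comment> \<open>H2\<close>
    and f_orth: "orthogonally_additive f"
    and f_pos: "\<And>u. u \<in> cone_in \<iota> \<Longrightarrow> f (\<iota> u) \<in> dual_cone"
    and f_neg: "\<And>u. - u \<in> cone_in \<iota> \<Longrightarrow> - f (\<iota> u) \<in> dual_cone"
    and f_bound: "\<And>u w. blinfun_apply (f (\<iota> u)) (\<iota> w) \<le> g (norm (\<iota> u)) * norm (\<iota> w)"
    and g_nonneg: "\<And>s. s \<ge> 0 \<Longrightarrow> g s \<ge> 0"
    and g_mono: "mono_on {0..} g"
    and g_lim: "((\<lambda>s. g s / s powr (p - 1)) \<longlongrightarrow> 0) (at_right 0)"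
    \<comment> \<open>H3\<close>
    and J_lim: "\<And>u. u \<noteq> 0 \<Longrightarrow> filterlim (\<lambda>t. J (t *\<^sub>R u)) at_bot at_top"
    \<comment> \<open>H4\<close>
    and PS: "\<And>(u :: nat \<Rightarrow> 'x) a b.
               (\<And>n. J (u n) \<in> {a..b}) \<Longrightarrow>
               (\<lambda>n. norm (u n - sol_op \<iota> T f (u n))) \<longlonglongrightarrow> 0 \<Longrightarrow>
               bounded (range u) \<and> (\<lambda>n. J' (u n)) \<longlonglongrightarrow> 0"
  shows "(\<exists>u. positive_solution \<iota> T f u) \<and>
         (\<exists>u. negative_solution \<iota> T f u) \<and>
         (\<exists>u. sign_changing_solution \<iota> T f u)"
proof -
  interpret superlinear_problem \<iota> J J' T f p c1 g
    by (rule superlinear_problem.intro; fact)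
  show ?thesis using dimX by (rule exists_solutions)
qed

end
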